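(* Let $p>0$ and let $n$ be a positive integer. Consider the MEMS problem \[ \Delta u+\frac{\lambda}{(1-u)^p}=0 \quad (|x|<1,\ x\in\mathbb{R}^n),\qquad u=0 \ \text{ on } |x|=1, \] with $w$, $\lambda(t)$ and $u_t$ as in the context. Then: (i) If $t_n>0$ satisfies $\lambda'(t_n)=0$ (a singular solution), then $\lambda''(t_n)\ne 0$. (ii) When one follows the solution curve in the direction of increasing $u(0)$, i.e. increasing $t$, the Morse index of the solution increases by one at each turn. That is, at each $t_n$ with $\lambda'(t_n)=0$, the Morse index of $u_t$ for $t$ slightly larger than $t_n$ exceeds by one the Morse index of $u_t$ for $t$ slightly smaller than $t_n$.
   Context: Solutions satisfy $0<u<1$; they are radial and decreasing in $|x|$. Let $w(t)$ be the solution of \[ w''+\frac{n-1}{t}w'=\frac{1}{w^p},\qquad w(0)=1,\quad w'(0)=0, \] which is positive and increasing and defined for all $t>0$. The solution set is the curve $t\mapsto(\lambda(t),u_t)$, $t\in(0,\infty)$, where \[ \lambda(t)=\frac{t^2}{w(t)^{p+1}},\qquad u_t(x)=1-\frac{w(t|x|)}{w(t)}. \] In particular $u_t(0)=1-1/w(t)$ is increasing in $t$. A turn is a value of $t$ at which $\lambda'(t)$ changes sign. The Morse index of $u_t$ is the number of negative eigenvalues $\mu$ of \[ \Delta\omega+\lambda(t)\frac{p}{(1-u_t)^{p+1}}\omega+\mu\omega=0 \ \text{ in } |x|<1,\qquad \omega=0 \text{ on } |x|=1. \] *)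

theory Defs
  imports "HOL-Analysis.Analysis" "HOL-Library.Function_Algebras"
begin

definition partial :: "'n::finite \<Rightarrow> (real^'n \<Rightarrow> real) \<Rightarrow> real^'n \<Rightarrow> real" where
  "partial i f x = deriv (\<lambda>r. f (x + r *\<^sub>R axis i 1)) 0"

definition laplacian :: "(real^'n::finite \<Rightarrow> real) \<Rightarrow> real^'n \<Rightarrow> real" where
  "laplacian f x = (\<Sum>i\<in>UNIV. partial i (partial i f) x)"

definition C2_on :: "(real^'n::finite) set \<Rightarrow> (real^'n \<Rightarrow> real) \<Rightarrow> bool" where
  "C2_on S f \<longleftrightarrow> f differentiable_on S \<and>
     (\<forall>i. partial i f differentiable_on S) \<and>
     (\<forall>i j. continuous_on S (partial j (partial i f)))"

text \<open>Classical Dirichlet eigenfunctions (zero function allowed) of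
  Delta omega + V omega + mu omega = 0 in the unit ball, omega = 0 on the unit sphere.
  Functions are normalised to vanish outside the closed ball.\<close>
definition dirichlet_eigenfunction ::
  "(real^'n::finite \<Rightarrow> real) \<Rightarrow> real \<Rightarrow> (real^'n \<Rightarrow> real) \<Rightarrow> bool" where
  "dirichlet_eigenfunction V \<mu> \<omega> \<longleftrightarrow>
     C2_on (ball 0 1) \<omega> \<and> continuous_on (cball 0 1) \<omega> \<and>
     (\<forall>x. 1 \<le> norm x \<longrightarrow> \<omega> x = 0) \<and>
     (\<forall>x\<in>ball 0 1. laplacian \<omega> x + V x * \<omega> x + \<mu> * \<omega> x = 0)"

definition dirichlet_eigenvalue :: "(real^'n::finite \<Rightarrow> real) \<Rightarrow> real \<Rightarrow> bool" where
  "dirichlet_eigenvalue V \<mu> \<longleftrightarrow> (\<exists>\<omega>. dirichlet_eigenfunction V \<mu> \<omega> \<and> \<omega> \<noteq> (\<lambda>_. 0))"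

definition eig_multiplicity :: "(real^'n::finite \<Rightarrow> real) \<Rightarrow> real \<Rightarrow> nat" where
  "eig_multiplicity V \<mu> =
     vector_space.dim (\<lambda>(c::real) (f::real^'n \<Rightarrow> real) x. c * f x)
       {\<omega>. dirichlet_eigenfunction V \<mu> \<omega>}"

definition morse_index :: "(real^'n::finite \<Rightarrow> real) \<Rightarrow> nat" where
  "morse_index V = (\<Sum>\<mu>\<in>{\<mu>. \<mu> < 0 \<and> dirichlet_eigenvalue V \<mu>}. eig_multiplicity V \<mu>)"

definition mems_profile :: "nat \<Rightarrow> real \<Rightarrow> (real \<Rightarrow> real) \<Rightarrow> bool" where
  "mems_profile n p w \<longleftrightarrow>
     w 0 = 1 \<and> (\<forall>t\<ge>0. w t > 0) \<and>
     (w has_real_derivative 0) (at_right 0) \<and> continuous (at_right 0) w \<and>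
     (\<exists>w'. (\<forall>t>0. (w has_real_derivative w' t) (at t)) \<and>
        (\<forall>t>0. (w' has_real_derivative
                   (1 / (w t powr p) - (real n - 1) / t * w' t)) (at t)))"

definition mems_lambda :: "real \<Rightarrow> (real \<Rightarrow> real) \<Rightarrow> real \<Rightarrow> real" where
  "mems_lambda p w t = t\<^sup>2 / (w t powr (p + 1))"

definition mems_u :: "(real \<Rightarrow> real) \<Rightarrow> real \<Rightarrow> real^'n::finite \<Rightarrow> real" where
  "mems_u w t x = 1 - w (t * norm x) / w t"

text \<open>Potential of the linearised operator at u_t.\<close>
definition mems_potential :: "real \<Rightarrow> (real \<Rightarrow> real) \<Rightarrow> real \<Rightarrow> real^'n::finite \<Rightarrow> real" where
  "mems_potential p w t x = mems_lambda p w t * p / ((1 - mems_u w t x) powr (p + 1))"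

end

theory Submission
  imports Defs
begin

text \<open>
The potential at \<open>u_t\<close> is \<open>t\<^sup>2 q(t |x|)\<close> with \<open>q = p / w powr (p + 1)\<close>, so after rescaling the index
counts the negative Dirichlet eigenvalues \<open>\<nu> = \<mu> / t\<^sup>2\<close> of one operator \<open>- \<Delta> - q\<close> on balls of growing
radius \<open>t\<close>.

Eigenfunctions with \<open>\<mu> < 0\<close> are radial: \<open>\<omega>\<close> minus its reflection in a hyperplane vanishes on the
boundary of a half ball, on which \<open>w'(t |x|) (x \<bullet> e) / |x|\<close> is a positive solution of the linearised
equation; perturbed to a strict supersolution that is positive on the closed half ball, it makes the maximum
principle applicable to the quotient. Hence the negative eigenvalues are simple and
the index is the number of \<open>\<nu> < 0\<close> with \<open>y(t, \<nu>) = 0\<close>, where \<open>y(\<cdot>, \<nu>)\<close> is the regular radial solution.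

Lagrange's identity makes every zero of \<open>y(t, \<cdot>)\<close> simple and lets the zeros move monotonically with \<open>t\<close>.
Finally \<open>\<lambda>'\<close> is a positive multiple of \<open>y(\<cdot>, 0) = w - (p + 1) / 2 \<cdot> t w'\<close>, so at a turn the
zero \<open>\<nu> = 0\<close> is simple and exactly one eigenvalue passes through \<open>0\<close>, becoming negative.
\<close>

section \<open>Regular solutions of the radial equation\<close>

text \<open>The coefficient \<open>m / r\<close> is singular at the origin, and regular solutions
  have to be told apart from singular ones there. Radial objects are therefore built from the
  averages \<open>avg\<close>, and a first derivative is carried as \<open>- y' / r\<close>, which
  extends continuously to \<open>r = 0\<close>; continuity and the values at the origin then come by
  construction. The count of negative zeros can change only through \<open>\<nu> = 0\<close>: a
  bounded potential keeps the zeros above \<open>- C\<close>, and zeros with a transversal sign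
  change neither merge nor split. Lagrange's identity for two parameters, with a factor that is
  positive near the diagonal, stands in for a derivative in \<open>\<nu>\<close>. Radial symmetry is
  where \<open>\<mu> < 0\<close> enters. The positive solution on the half ball vanishes on the flat
  side, so a quotient by it makes no sense there. Adding a Gaussian repairs this, and the strictly
  negative contribution of \<open>\<mu>\<close> pays for the error that the Gaussian causes.\<close>

definition avg :: "nat \<Rightarrow> (real \<Rightarrow> real) \<Rightarrow> real \<Rightarrow> real" where
  "avg m g r = integral {0..1} (\<lambda>b. b ^ m * g (r * b))"

text \<open>The second coordinate will be the spectral parameter: counting zeros requires continuity
  in radius and parameter jointly.\<close>

lemma continuous_on_avg_param:
  fixes h :: "real \<Rightarrow> 'a::topological_space \<Rightarrow> real"
  assumes "continuous_on UNIV (\<lambda>z. h (fst z) (snd z))"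
  shows "continuous_on UNIV (\<lambda>z. avg m (\<lambda>s. h s (snd z)) (fst z))"
proof -
  have "continuous_on (UNIV \<times> cbox 0 1) (\<lambda>(z, b). b ^ m * h (fst z * b) (snd z))"
    unfolding case_prod_unfold
    by (intro continuous_intros continuous_on_compose2[OF assms, of _ "\<lambda>y. (fst (fst y) * snd y, snd (fst y))", simplified])
  from integral_continuous_on_param[OF this] show ?thesis by (simp add: avg_def)
qed

lemma continuous_on_avg:
  assumes "continuous_on UNIV g"
  shows "continuous_on UNIV (avg m g)"
proof -
  have "continuous_on UNIV (\<lambda>z::real \<times> real. g (fst z))"
    by (intro continuous_on_compose2[OF assms] continuous_intros) auto
  from continuous_on_avg_param[where h = "\<lambda>s _. g s", OF this]
  have c: "continuous_on UNIV (\<lambda>z::real \<times> real. avg m g (fst z))" by simp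
  show ?thesis
    by (rule continuous_on_compose2[OF c, of UNIV "\<lambda>r. (r, 0)", simplified]) (intro continuous_intros)
qed

lemma avg_integrand_cont:
  fixes g :: "real \<Rightarrow> real"
  assumes "continuous_on UNIV g"
  shows "continuous_on A (\<lambda>b. b ^ m * g (r * b))"
  by (intro continuous_intros continuous_on_compose2[OF assms]) auto

lemma avg_integrand_int:
  fixes g :: "real \<Rightarrow> real"
  assumes "continuous_on UNIV g"
  shows "(\<lambda>b. b ^ m * g (r * b)) integrable_on {0..1}"
  by (rule integrable_continuous_interval) (rule avg_integrand_cont[OF assms])

lemma integral_power_unit: "((\<lambda>b::real. b ^ k) has_integral 1 / (real k + 1)) {0..1}"
proof -
  have "((\<lambda>b::real. b ^ k) has_integral (1 ^ Suc k / real (Suc k) - 0 ^ Suc k / real (Suc k))) {0..1}"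
    by (rule fundamental_theorem_of_calculus)
      (auto intro!: derivative_eq_intros
        simp: has_real_derivative_iff_has_vector_derivative[symmetric] field_simps simp del: of_nat_Suc power_Suc)
  then show ?thesis by (simp add: add.commute)
qed

lemma avg_0: "avg m g 0 = g 0 / (real m + 1)"
proof -
  have "((\<lambda>b. b ^ m * g 0) has_integral (1 / (real m + 1) * g 0)) {0..1}"
    by (rule has_integral_mult_left[OF integral_power_unit])
  from integral_unique[OF this] show ?thesis by (simp add: avg_def)
qed

lemma eventually_nhds_pos:
  assumes "(r::real) > 0" "\<And>x. x > 0 \<Longrightarrow> P x"
  shows "\<forall>\<^sub>F x in nhds r. P x"
proof -
  have "\<forall>\<^sub>F x in nhds r. x \<in> {0<..}" using assms(1) by (intro eventually_nhds_in_open) auto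
  then show ?thesis by eventually_elim (use assms(2) in auto)
qed

text \<open>The substitution \<open>s = r * b\<close> turns \<open>r ^ Suc m * avg m g r\<close>
  into the integral of \<open>s ^ m * g s\<close> over \<open>{0..r}\<close>. So
  \<open>f r = r * avg m g r\<close> is the regular solution of
  \<open>(r ^ m * f)' = r ^ m * g\<close>.\<close>

lemma DERIV_power_avg:
  assumes g: "continuous_on UNIV g" and r: "r > 0"
  shows "((\<lambda>r. r ^ Suc m * avg m g r) has_real_derivative r ^ m * g r) (at r)"
proof -
  let ?f = "\<lambda>s. s ^ m * g s"
  have cf: "continuous_on A ?f" for A
    by (intro continuous_intros continuous_on_subset[OF g]) auto
  have eq: "x ^ Suc m * avg m g x = integral {0..x} ?f" if "x > 0" for x
  proof -
    have im: "(\<lambda>y. y / x) ` {0..x} = {0..1}"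
    proof
      show "{0..1} \<subseteq> (\<lambda>y. y / x) ` {0..x}"
      proof
        fix y :: real assume "y \<in> {0..1}"
        then show "y \<in> (\<lambda>y. y / x) ` {0..x}" using that
          by (intro image_eqI[of _ _ "y * x"]) (auto simp: mult_left_le_one_le)
      qed
    qed (use that in auto)
    have "integral {0..1} (\<lambda>y. ?f (x * y)) = (1 / x) * integral {0..x} ?f"
      using integral_stretch_real[of x 0 x ?f] that im by simp
    moreover have "integral {0..1} (\<lambda>y. ?f (x * y)) = x ^ m * avg m g x"
      unfolding avg_def by (simp add: power_mult_distrib mult.assoc flip: integral_mult_right)
    ultimately show ?thesis using that by (simp add: field_simps)
  qed
  have "((\<lambda>x. integral {0..x} ?f) has_real_derivative ?f r) (at r within {0..r+1})"
    by (rule integral_has_real_derivative[OF cf]) (use r in auto)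
  moreover have "r \<in> interior {0..r + 1}" using r by simp
  ultimately have "((\<lambda>x. integral {0..x} ?f) has_real_derivative ?f r) (at r)"
    by (simp only: at_within_interior)
  moreover have "\<forall>\<^sub>F x in nhds r. x ^ Suc m * avg m g x = integral {0..x} ?f"
    using eq by (intro eventually_nhds_pos r)
  ultimately show ?thesis by (subst DERIV_cong_ev[OF refl _ refl])
qed

lemma DERIV_mpower:
  assumes "(r::real) > 0"
  shows "((\<lambda>r. r ^ m) has_real_derivative real m / r * r ^ m) (at r)"
  using DERIV_pow[of m r] assms by (cases m) simp_all

lemma DERIV_avg:
  assumes g: "continuous_on UNIV g" and r: "r > 0"
  shows "(avg m g has_real_derivative (g r - real (Suc m) * avg m g r) / r) (at r)"
proof -
  have "((\<lambda>r. (r ^ Suc m * avg m g r) / r ^ Suc m) has_real_derivative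
     ((r ^ m * g r) * r ^ Suc m - (r ^ Suc m * avg m g r) * (real (Suc m) / r * r ^ Suc m)) / (r ^ Suc m * r ^ Suc m)) (at r)"
    by (intro derivative_intros DERIV_power_avg[OF g r] DERIV_mpower r) (use r in auto)
  moreover have "\<forall>\<^sub>F x in nhds r. (x ^ Suc m * avg m g x) / x ^ Suc m = avg m g x"
    by (intro eventually_nhds_pos r) simp
  ultimately have "(avg m g has_real_derivative
     ((r ^ m * g r) * r ^ Suc m - (r ^ Suc m * avg m g r) * (real (Suc m) / r * r ^ Suc m)) / (r ^ Suc m * r ^ Suc m)) (at r)"
    by (simp add: DERIV_cong_ev[OF refl _ refl])
  then show ?thesis
    by (rule DERIV_cong) (use r in \<open>simp add: divide_simps\<close>, simp add: algebra_simps)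
qed

text \<open>A bound of order \<open>2 * k\<close> raises the weight to
  \<open>b ^ (m + 2 * k)\<close>, whose integral is the reciprocal of the denominator. Repeated use
  of such denominators builds the factorial in the Picard estimate.\<close>

lemma avg_bound:
  assumes g: "continuous_on UNIV g" and b: "\<And>s. \<bar>s\<bar> \<le> \<bar>r\<bar> \<Longrightarrow> \<bar>g s\<bar> \<le> B * (s\<^sup>2) ^ k"
  shows "\<bar>avg m g r\<bar> \<le> B * (r\<^sup>2) ^ k / (real (m + 2 * k) + 1)"
proof -
  have hi: "((\<lambda>x. x ^ (m + 2 * k) * (B * (r\<^sup>2) ^ k)) has_integral (1 / (real (m + 2 * k) + 1) * (B * (r\<^sup>2) ^ k))) {0..1}"
    by (rule has_integral_mult_left[OF integral_power_unit])
  have "norm (integral {0..1} (\<lambda>b. b ^ m * g (r * b))) \<le> integral {0..1} (\<lambda>x. x ^ (m + 2 * k) * (B * (r\<^sup>2) ^ k))"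
  proof (rule integral_norm_bound_integral[OF avg_integrand_int[OF g]])
    show "(\<lambda>x. x ^ (m + 2 * k) * (B * (r\<^sup>2) ^ k)) integrable_on {0..1}" using hi by blast
    fix x :: real assume x: "x \<in> {0..1}"
    have "\<bar>g (r * x)\<bar> \<le> B * ((r * x)\<^sup>2) ^ k"
      by (rule b) (use x in \<open>auto simp: abs_mult mult_left_le\<close>)
    then have "x ^ m * \<bar>g (r * x)\<bar> \<le> x ^ m * (B * ((r * x)\<^sup>2) ^ k)"
      using x by (intro mult_left_mono) auto
    also have "((r * x)\<^sup>2) ^ k = x ^ (2 * k) * (r\<^sup>2) ^ k"
      by (simp add: power_mult_distrib mult.commute flip: power_mult)
    finally show "norm (x ^ m * g (r * x)) \<le> x ^ (m + 2 * k) * (B * (r\<^sup>2) ^ k)"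
      using x by (simp add: abs_mult power_add mult_ac)
  qed
  then show ?thesis using integral_unique[OF hi] by (simp add: avg_def)
qed

lemma avg_bound0:
  assumes g: "continuous_on UNIV g" and b: "\<And>s. \<bar>s\<bar> \<le> \<bar>r\<bar> \<Longrightarrow> \<bar>g s\<bar> \<le> B"
  shows "\<bar>avg m g r\<bar> \<le> B"
proof -
  have "B \<ge> 0" using b[of 0] by simp
  then have "B / (real m + 1) \<le> B" by (simp add: divide_simps mult_left_le algebra_simps)
  then show ?thesis using avg_bound[OF g, of r B 0 m] b by simp
qed

lemma avg_nonneg:
  assumes "continuous_on UNIV g" "\<And>s. g s \<ge> 0"
  shows "avg m g r \<ge> 0"
  unfolding avg_def by (rule integral_nonneg[OF avg_integrand_int]) (use assms in auto)

text \<open>A vanishing average would make the integrand zero on all of \<open>{0..1}\<close>, yet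
  for small positive \<open>b\<close> the value \<open>g (r * b)\<close> is close to
  \<open>g 0\<close>.\<close>

lemma avg_pos:
  assumes g: "continuous_on UNIV g" and nn: "\<And>s. g s \<ge> 0" and g0: "g 0 > 0"
  shows "avg m g r > 0"
proof -
  have "avg m g r \<noteq> 0"
  proof
    assume "avg m g r = 0"
    then have z: "\<And>x. x \<in> {0..1} \<Longrightarrow> x ^ m * g (r * x) = 0"
      unfolding avg_def
      by (subst (asm) integral_eq_0_iff[OF avg_integrand_cont[OF g]]) (use nn in auto)
    have "isCont g 0" using g by (simp add: continuous_on_eq_continuous_at)
    then have "((\<lambda>x. g (r * x)) \<longlongrightarrow> g 0) (at_right 0)"
      by (rule isCont_tendsto_compose) (auto intro!: tendsto_eq_intros)
    then have "\<forall>\<^sub>F x in at_right 0. g (r * x) > 0" using g0 by (rule order_tendstoD)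
    moreover have "\<forall>\<^sub>F x in at_right (0::real). x \<in> {0<..<1}"
      by (rule eventually_at_right_real) simp
    ultimately have "\<forall>\<^sub>F x in at_right (0::real). False"
    proof eventually_elim
      case (elim x) with z[of x] show ?case by auto
    qed
    then show False by simp
  qed
  with avg_nonneg[OF g nn, of m r] show ?thesis by linarith
qed

lemma avg_add: "continuous_on UNIV f \<Longrightarrow> continuous_on UNIV g \<Longrightarrow> avg m (\<lambda>s. f s + g s) r = avg m f r + avg m g r"
  unfolding avg_def using avg_integrand_int[of f m r] avg_integrand_int[of g m r]
  by (simp add: distrib_left integral_add)

lemma avg_diff: "continuous_on UNIV f \<Longrightarrow> continuous_on UNIV g \<Longrightarrow> avg m (\<lambda>s. f s - g s) r = avg m f r - avg m g r"
  unfolding avg_def using avg_integrand_int[of f m r] avg_integrand_int[of g m r]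
  by (simp add: right_diff_distrib integral_diff)

lemma avg_minus: "avg m (\<lambda>s. - f s) r = - avg m f r"
  unfolding avg_def by simp

lemma continuous_on_slice:
  fixes F :: "real \<times> real \<Rightarrow> real"
  assumes "continuous_on UNIV F" shows "continuous_on A (\<lambda>r. F (r, \<nu>))"
  by (rule continuous_on_compose2[OF assms, of A "\<lambda>r. (r,\<nu>)"]) (auto intro: continuous_intros)

section \<open>The Picard series, Lagrange's identity and the bound on the zeros\<close>

locale radial_schroedinger =
  fixes m :: nat and q :: "real \<Rightarrow> real" and C :: real
  assumes q_cont: "continuous_on UNIV q" and q_nonneg: "\<And>r. 0 \<le> q r" and q_le: "\<And>r. q r \<le> C"
begin

text \<open>These are the terms of the series, not its partial sums. The operator
  \<open>r\<^sup>2 * avg 1 (avg m g) r\<close> inverts the radial Laplacian in dimension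
  \<open>Suc m\<close> with value 0 at the origin, so each term solves the equation with the
  previous term as source.\<close>

fun picard :: "nat \<Rightarrow> real \<Rightarrow> real \<Rightarrow> real" where
  "picard 0 \<nu> r = 1"
| "picard (Suc k) \<nu> r = - r\<^sup>2 * avg 1 (avg m (\<lambda>s. (q s + \<nu>) * picard k \<nu> s)) r"

lemma picard_cont: "continuous_on UNIV (\<lambda>z. picard k (snd z) (fst z))"
proof (induction k)
  case (Suc k)
  have "continuous_on UNIV (\<lambda>z::real\<times>real. (q (fst z) + snd z) * picard k (snd z) (fst z))"
    by (intro continuous_intros continuous_on_compose2[OF q_cont] Suc) auto
  from continuous_on_avg_param[where h = "\<lambda>s \<nu>. (q s + \<nu>) * picard k \<nu> s", OF this]
  have c1: "continuous_on UNIV (\<lambda>z. avg m (\<lambda>s. (q s + snd z) * picard k (snd z) s) (fst z))" .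
  from continuous_on_avg_param[where h = "\<lambda>s \<nu>. avg m (\<lambda>s. (q s + \<nu>) * picard k \<nu> s) s", OF this]
  show ?case by (auto intro!: continuous_intros)
qed simp

lemma picard_cont1: "continuous_on A (picard k \<nu>)"
  using continuous_on_slice[OF picard_cont, of A k \<nu>] by simp

lemma integrand_cont1:
  "continuous_on A f \<Longrightarrow> continuous_on A (\<lambda>s. (q s + \<nu>) * f s)"
  by (intro continuous_intros continuous_on_subset[OF q_cont]) auto

lemma C_nonneg: "0 \<le> C" using q_nonneg[of 0] q_le[of 0] by simp

lemma q_shift_bound: "\<bar>q s + \<nu>\<bar> \<le> C + \<bar>\<nu>\<bar>"
  using q_nonneg[of s] q_le[of s] by linarith

text \<open>The outer average divides by \<open>2 * k + 2\<close>, which exceeds the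
  \<open>k + 1\<close> that the factorial asks for; the denominator of the inner average is
  estimated by 1.\<close>

lemma picard_bound: "\<bar>picard k \<nu> r\<bar> \<le> ((C + \<bar>\<nu>\<bar>) ^ k / fact k) * (r\<^sup>2) ^ k"
proof (induction k arbitrary: r)
  case (Suc k)
  let ?D = "C + \<bar>\<nu>\<bar>"
  let ?B = "?D * (?D ^ k / fact k)"
  have D0: "?D \<ge> 0" using C_nonneg by simp
  have i1: "continuous_on UNIV (\<lambda>s. (q s + \<nu>) * picard k \<nu> s)"
    by (rule integrand_cont1) (rule picard_cont1)
  have b1: "\<bar>(q s + \<nu>) * picard k \<nu> s\<bar> \<le> ?B * (s\<^sup>2) ^ k" for s
    unfolding abs_mult mult.assoc
    by (rule mult_mono) (use q_shift_bound Suc D0 in \<open>auto simp: mult.assoc[symmetric]\<close>)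
  have b2: "\<bar>avg m (\<lambda>s. (q s + \<nu>) * picard k \<nu> s) s\<bar> \<le> ?B * (s\<^sup>2) ^ k" for s
  proof -
    have "\<bar>avg m (\<lambda>s. (q s + \<nu>) * picard k \<nu> s) s\<bar> \<le> ?B * (s\<^sup>2) ^ k / (real (m + 2 * k) + 1)"
      by (rule avg_bound[OF i1 b1])
    also have "\<dots> \<le> ?B * (s\<^sup>2) ^ k / 1"
      by (rule divide_left_mono) (use D0 in auto)
    finally show ?thesis by simp
  qed
  have "\<bar>avg 1 (avg m (\<lambda>s. (q s + \<nu>) * picard k \<nu> s)) r\<bar> \<le> ?B * (r\<^sup>2) ^ k / (real (1 + 2 * k) + 1)"
    by (rule avg_bound[OF continuous_on_avg[OF i1] b2])
  also have "\<dots> \<le> ?B * (r\<^sup>2) ^ k / (real k + 1)"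
    by (rule divide_left_mono) (use D0 in auto)
  finally have "r\<^sup>2 * \<bar>avg 1 (avg m (\<lambda>s. (q s + \<nu>) * picard k \<nu> s)) r\<bar> \<le> r\<^sup>2 * (?B * (r\<^sup>2) ^ k / (real k + 1))"
    by (rule mult_left_mono) simp
  also have "\<dots> = (?D ^ Suc k / fact (Suc k)) * (r\<^sup>2) ^ Suc k"
    by (simp add: field_simps)
  finally show ?case by (simp add: abs_mult)
qed simp

definition sol :: "real \<Rightarrow> real \<Rightarrow> real" where
  "sol \<nu> r = (\<Sum>k. picard k \<nu> r)"

lemma picard_uniform:
  "uniform_limit ({-R..R} \<times> {-R..R}) (\<lambda>n z. \<Sum>k<n. picard k (snd z) (fst z)) (\<lambda>z. sol (snd z) (fst z)) sequentially"
  unfolding sol_def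
proof (rule Weierstrass_m_test)
  show "summable (\<lambda>k. ((C + R) * R\<^sup>2) ^ k /\<^sub>R fact k)" by (rule summable_exp_generic)
  fix k and z :: "real \<times> real" assume "z \<in> {-R..R} \<times> {-R..R}"
  then obtain r \<nu> where z: "z = (r, \<nu>)" "\<bar>r\<bar> \<le> R" "\<bar>\<nu>\<bar> \<le> R" by (cases z) auto
  have R0: "0 \<le> R" using z(2) by linarith
  have r2: "r\<^sup>2 \<le> R\<^sup>2" using z by (metis abs_ge_zero power2_abs power_mono)
  have "\<bar>picard k \<nu> r\<bar> \<le> ((C + \<bar>\<nu>\<bar>) ^ k / fact k) * (r\<^sup>2) ^ k" by (rule picard_bound)
  also have "\<dots> \<le> ((C + R) ^ k / fact k) * (R\<^sup>2) ^ k"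
    using z(2,3) r2 R0 C_nonneg by (intro mult_mono divide_right_mono power_mono[of "C + \<bar>\<nu>\<bar>"] power_mono[OF r2] divide_nonneg_nonneg) auto
  finally show "norm (picard k (snd z) (fst z)) \<le> ((C + R) * R\<^sup>2) ^ k /\<^sub>R fact k"
    using z by (simp add: power_mult_distrib divide_inverse mult_ac)
qed

lemma sol_cont: "continuous_on UNIV (\<lambda>z. sol (snd z) (fst z))"
proof -
  have "continuous (at z) (\<lambda>z. sol (snd z) (fst z))" for z :: "real \<times> real"
  proof -
    obtain r \<nu> where z: "z = (r, \<nu>)" by (cases z)
    define R where "R = \<bar>r\<bar> + \<bar>\<nu>\<bar> + 1"
    have "continuous_on ({-R..R} \<times> {-R..R}) (\<lambda>z. sol (snd z) (fst z))"
      by (rule uniform_limit_theorem[OF _ picard_uniform])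
        (auto intro!: always_eventually continuous_on_sum continuous_on_subset[OF picard_cont])
    moreover have "z \<in> interior ({-R..R} \<times> {-R..R})"
      by (auto simp: interior_Times z R_def)
    ultimately show ?thesis by (rule continuous_on_interior)
  qed
  then show ?thesis by (simp add: continuous_at_imp_continuous_on)
qed

lemma sol_cont1: "continuous_on A (sol \<nu>)"
  using continuous_on_slice[OF sol_cont, of A \<nu>] by simp

text \<open>This is \<open>- y' / r\<close> for \<open>y = sol \<nu>\<close>, given by an integral
  so that it is continuous at the origin.\<close>

definition sol_slope :: "real \<Rightarrow> real \<Rightarrow> real" where
  "sol_slope \<nu> = avg m (\<lambda>s. (q s + \<nu>) * sol \<nu> s)"

lemma picard_sum_rec:
  "(\<Sum>k<Suc n. picard k \<nu> r) = 1 - r\<^sup>2 * avg 1 (avg m (\<lambda>s. (q s + \<nu>) * (\<Sum>k<n. picard k \<nu> s))) r"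
proof (induction n arbitrary: r)
  case 0
  have "avg k (\<lambda>s. 0) = (\<lambda>r. 0)" for k by (auto simp: avg_def)
  then show ?case by simp
next
  case (Suc n)
  have c: "continuous_on UNIV (\<lambda>s. (q s + \<nu>) * (\<Sum>k<n. picard k \<nu> s))"
    "continuous_on UNIV (\<lambda>s. (q s + \<nu>) * picard n \<nu> s)"
    by (intro integrand_cont1 continuous_on_sum picard_cont1)+
  have "avg m (\<lambda>s. (q s + \<nu>) * (\<Sum>k<Suc n. picard k \<nu> s)) =
      (\<lambda>r. avg m (\<lambda>s. (q s + \<nu>) * (\<Sum>k<n. picard k \<nu> s)) r + avg m (\<lambda>s. (q s + \<nu>) * picard n \<nu> s) r)"
    by (auto simp: distrib_left avg_add[OF c, symmetric])
  then have "avg 1 (avg m (\<lambda>s. (q s + \<nu>) * (\<Sum>k<Suc n. picard k \<nu> s))) r =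
      avg 1 (avg m (\<lambda>s. (q s + \<nu>) * (\<Sum>k<n. picard k \<nu> s))) r + avg 1 (avg m (\<lambda>s. (q s + \<nu>) * picard n \<nu> s)) r"
    by (simp add: avg_add[OF continuous_on_avg continuous_on_avg, OF c])
  then show ?case
    using Suc.IH[of r] by (subst sum.lessThan_Suc) (simp add: algebra_simps)
qed

text \<open>The integral operator is continuous for uniform convergence, so the recursion of the
  partial sums passes to the limit. The radius \<open>R\<close> dominates \<open>r\<close> and
  \<open>\<nu>\<close>, hence all arguments reached by the two averages stay in the square of
  uniform convergence.\<close>

lemma sol_fixpoint: "sol \<nu> r = 1 - r\<^sup>2 * avg 1 (sol_slope \<nu>) r"
proof -
  define R where "R = \<bar>r\<bar> + \<bar>\<nu>\<bar>"
  let ?s = "\<lambda>n s. \<Sum>k<n. picard k \<nu> s"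
  let ?T = "\<lambda>f. avg 1 (avg m (\<lambda>s. (q s + \<nu>) * f s)) r"
  have D0: "C + \<bar>\<nu>\<bar> \<ge> 0" using C_nonneg by simp
  have cs: "continuous_on UNIV (\<lambda>s. ?s n s)" for n by (intro continuous_on_sum picard_cont1)
  have "(\<lambda>n. ?T (?s n)) \<longlonglongrightarrow> ?T (sol \<nu>)"
  proof (rule LIMSEQ_I)
    fix e :: real assume "e > 0"
    define e' where "e' = e / (C + \<bar>\<nu>\<bar> + 1)"
    have "e' > 0" using \<open>e > 0\<close> D0 by (simp add: e'_def)
    from uniform_limitD[OF picard_uniform[of R] this]
    obtain N where N: "\<And>n z. n \<ge> N \<Longrightarrow> z \<in> {-R..R} \<times> {-R..R} \<Longrightarrow> dist (\<Sum>k<n. picard k (snd z) (fst z)) (sol (snd z) (fst z)) < e'"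
      unfolding eventually_sequentially by blast
    have "norm (?T (?s n) - ?T (sol \<nu>)) < e" if n: "n \<ge> N" for n
    proof -
      have c: "continuous_on UNIV (\<lambda>s. (q s + \<nu>) * ?s n s)" "continuous_on UNIV (\<lambda>s. (q s + \<nu>) * sol \<nu> s)"
        by (intro integrand_cont1 cs sol_cont1)+
      have c2: "continuous_on UNIV (\<lambda>s. (q s + \<nu>) * ?s n s - (q s + \<nu>) * sol \<nu> s)"
        by (intro continuous_intros c)
      have "?T (?s n) - ?T (sol \<nu>) = avg 1 (avg m (\<lambda>s. (q s + \<nu>) * ?s n s - (q s + \<nu>) * sol \<nu> s)) r"
        unfolding avg_diff[OF c, abs_def] by (rule avg_diff[OF continuous_on_avg continuous_on_avg, OF c, symmetric])
      also have "\<bar>\<dots>\<bar> \<le> (C + \<bar>\<nu>\<bar>) * e'"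
      proof (rule avg_bound0[OF continuous_on_avg[OF c2]], rule avg_bound0[OF c2])
        fix s s' assume "\<bar>s\<bar> \<le> \<bar>r\<bar>" "\<bar>s'\<bar> \<le> \<bar>s\<bar>"
        then have "- R \<le> s'" "s' \<le> R" "- R \<le> \<nu>" "\<nu> \<le> R" unfolding R_def by linarith+
        then have "dist (?s n s') (sol \<nu> s') < e'"
          using N[OF n, of "(s', \<nu>)"] by simp
        then have "\<bar>q s' + \<nu>\<bar> * \<bar>?s n s' - sol \<nu> s'\<bar> \<le> (C + \<bar>\<nu>\<bar>) * e'"
          using D0 by (intro mult_mono q_shift_bound) (auto simp: dist_real_def)
        then show "\<bar>(q s' + \<nu>) * ?s n s' - (q s' + \<nu>) * sol \<nu> s'\<bar> \<le> (C + \<bar>\<nu>\<bar>) * e'"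
          by (simp add: abs_mult[symmetric] algebra_simps)
      qed
      also have "\<dots> < e" using D0 \<open>e > 0\<close> by (simp add: e'_def field_simps)
      finally show ?thesis by simp
    qed
    then show "\<exists>no. \<forall>n\<ge>no. norm (?T (?s n) - ?T (sol \<nu>)) < e" by blast
  qed
  then have "(\<lambda>n. 1 - r\<^sup>2 * ?T (?s n)) \<longlonglongrightarrow> 1 - r\<^sup>2 * ?T (sol \<nu>)"
    by (intro tendsto_intros)
  then have A: "(\<lambda>n. ?s (Suc n) r) \<longlonglongrightarrow> 1 - r\<^sup>2 * avg 1 (sol_slope \<nu>) r"
    unfolding picard_sum_rec sol_slope_def .
  have "(\<lambda>n. ?s n r) \<longlonglongrightarrow> sol \<nu> r"
  proof -
    have "- R \<le> r" "r \<le> R" "- R \<le> \<nu>" "\<nu> \<le> R" unfolding R_def by linarith+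
    then show ?thesis using tendsto_uniform_limitI[OF picard_uniform[of R], of "(r, \<nu>)"] by simp
  qed
  then have B: "(\<lambda>n. ?s (Suc n) r) \<longlonglongrightarrow> sol \<nu> r" by (rule LIMSEQ_Suc)
  show ?thesis by (rule LIMSEQ_unique[OF B A])
qed

lemma sol_slope_cont: "continuous_on UNIV (sol_slope \<nu>)"
  unfolding sol_slope_def by (intro continuous_on_avg integrand_cont1 sol_cont1)

lemma sol_0: "sol \<nu> 0 = 1" by (subst sol_fixpoint) simp

lemma sol_slope_0: "sol_slope \<nu> 0 = (q 0 + \<nu>) * sol \<nu> 0 / real (Suc m)"
  by (simp add: sol_slope_def avg_0 add.commute)

lemma DERIV_sol: assumes "r > 0" shows "(sol \<nu> has_real_derivative - r * sol_slope \<nu> r) (at r)"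
proof -
  have "((\<lambda>r. 1 - r ^ Suc 1 * avg 1 (sol_slope \<nu>) r) has_real_derivative 0 - r ^ 1 * sol_slope \<nu> r) (at r)"
    by (intro derivative_intros DERIV_power_avg sol_slope_cont assms)
  moreover have "sol \<nu> = (\<lambda>r. 1 - r ^ Suc 1 * avg 1 (sol_slope \<nu>) r)"
    by (rule ext, subst sol_fixpoint) (simp add: power2_eq_square)
  ultimately show ?thesis by simp
qed

lemma DERIV_sol_slope: assumes "r > 0"
  shows "(sol_slope \<nu> has_real_derivative ((q r + \<nu>) * sol \<nu> r - real (Suc m) * sol_slope \<nu> r) / r) (at r)"
  unfolding sol_slope_def by (rule DERIV_avg) (use assms in \<open>auto intro!: integrand_cont1 sol_cont1\<close>)

text \<open>In the derivative of \<open>r ^ Suc m\<close> times the left side the potential and the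
  products of slopes cancel, leaving \<open>(\<nu>2 - \<nu>1) * r ^ m\<close> times the product of
  the solutions. The factor \<open>r ^ Suc m\<close> removes any boundary term at the
  origin.\<close>

lemma sol_lagrange:
  assumes "r > 0"
  shows "sol_slope \<nu>2 r * sol \<nu>1 r - sol_slope \<nu>1 r * sol \<nu>2 r = (\<nu>2 - \<nu>1) * avg m (\<lambda>s. sol \<nu>1 s * sol \<nu>2 s) r"
proof -
  let ?g = "\<lambda>s. sol \<nu>1 s * sol \<nu>2 s"
  let ?F = "\<lambda>r. r ^ Suc m * (sol_slope \<nu>2 r * sol \<nu>1 r - sol_slope \<nu>1 r * sol \<nu>2 r) - (\<nu>2 - \<nu>1) * (r ^ Suc m * avg m ?g r)"
  have cg: "continuous_on UNIV ?g" by (intro continuous_intros sol_cont1)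
  have "?F r = ?F 0"
  proof (rule DERIV_isconst_end[OF assms])
    show "continuous_on {0..r} ?F"
      by (intro continuous_intros sol_cont1 continuous_on_subset[OF sol_slope_cont] continuous_on_subset[OF continuous_on_avg[OF cg]]) auto
    fix x assume x: "0 < x" "x < r"
    show "(?F has_real_derivative 0) (at x)"
      by (rule DERIV_cong, (rule derivative_intros DERIV_sol DERIV_sol_slope DERIV_mpower DERIV_power_avg[OF cg] x)+)
        (use x in \<open>simp add: field_simps\<close>)
  qed
  then have "r ^ Suc m * (sol_slope \<nu>2 r * sol \<nu>1 r - sol_slope \<nu>1 r * sol \<nu>2 r) = r ^ Suc m * ((\<nu>2 - \<nu>1) * avg m ?g r)"
    by simp
  then show ?thesis using assms by simp
qed

text \<open>With \<open>q + \<nu> \<le> 0\<close> the sign in the recursion makes every Picard term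
  nonnegative, and the first term is 1. All zeros in \<open>\<nu>\<close> therefore lie above
  \<open>- C\<close>, which confines the count of negative zeros to a compact interval.\<close>

lemma sol_pos_below: assumes "\<nu> \<le> - C" shows "sol \<nu> r > 0"
proof -
  have neg: "q s + \<nu> \<le> 0" for s using q_le[of s] assms by simp
  have nn: "picard k \<nu> r \<ge> 0" for k r
  proof (induction k arbitrary: r)
    case (Suc k)
    let ?h = "\<lambda>s. - ((q s + \<nu>) * picard k \<nu> s)"
    have c: "continuous_on UNIV ?h" by (intro continuous_intros integrand_cont1 picard_cont1)
    have "avg m ?h s \<ge> 0" for s
      by (rule avg_nonneg[OF c]) (use neg Suc in \<open>auto simp: mult_nonpos_nonneg\<close>)
    then have "avg 1 (avg m ?h) r \<ge> 0" by (rule avg_nonneg[OF continuous_on_avg[OF c]])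
    then have "avg 1 (avg m (\<lambda>s. (q s + \<nu>) * picard k \<nu> s)) r \<le> 0"
      by (simp add: avg_minus avg_minus[abs_def])
    then show ?case by (auto simp: mult_nonneg_nonpos)
  qed simp
  have "summable (\<lambda>k. picard k \<nu> r)"
  proof (rule summable_comparison_test)
    show "summable (\<lambda>k. ((C + \<bar>\<nu>\<bar>) * r\<^sup>2) ^ k /\<^sub>R fact k)" by (rule summable_exp_generic)
    show "\<exists>N. \<forall>n\<ge>N. norm (picard n \<nu> r) \<le> ((C + \<bar>\<nu>\<bar>) * r\<^sup>2) ^ n /\<^sub>R fact n"
      using picard_bound[of _ \<nu> r] by (auto simp: power_mult_distrib divide_inverse mult_ac)
  qed
  then have "(\<Sum>k<1. picard k \<nu> r) \<le> sol \<nu> r"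
    unfolding sol_def by (rule sum_le_suminf) (use nn in auto)
  then show ?thesis by simp
qed

text \<open>For \<open>r > 0\<close> this is the weighted L2 product of the two solutions on
  \<open>{0..r}\<close> divided by \<open>r ^ Suc m\<close>, the right factor in Lagrange's
  identity.\<close>

definition sol_overlap :: "real \<Rightarrow> real \<Rightarrow> real \<Rightarrow> real" where
  "sol_overlap r \<nu>1 \<nu>2 = avg m (\<lambda>s. sol \<nu>1 s * sol \<nu>2 s) r"

lemma sol_overlap_cont: "continuous_on UNIV (\<lambda>z. sol_overlap (fst z) (fst (snd z)) (snd (snd z)))"
proof -
  have "continuous_on UNIV (\<lambda>z::real\<times>real\<times>real. sol (fst (snd z)) (fst z) * sol (snd (snd z)) (fst z))"
    by (intro continuous_intros
        continuous_on_compose2[OF sol_cont, of _ "\<lambda>z. (fst z, fst (snd z))", simplified]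
        continuous_on_compose2[OF sol_cont, of _ "\<lambda>z. (fst z, snd (snd z))", simplified])
  from continuous_on_avg_param[where h = "\<lambda>s n. sol (fst n) s * sol (snd n) s", OF this]
  show ?thesis by (simp add: sol_overlap_def)
qed

lemma sol_overlap_pos: "sol_overlap r \<nu> \<nu> > 0"
  unfolding sol_overlap_def by (rule avg_pos) (auto intro!: continuous_intros sol_cont1 simp: sol_0)

end

section \<open>Counting zeros at a crossing\<close>

text \<open>Here \<open>f\<close> stands for the solution, \<open>d\<close> for its slope
  \<open>- f' / r\<close> and \<open>J\<close> for the overlap. Formally \<open>ident\<close> gives
  the partial derivative \<open>- J / d\<close> of \<open>f\<close> in \<open>\<nu>\<close> at a
  zero, and \<open>df\<close> gives \<open>- a * d\<close> in \<open>t\<close>; the branch through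
  \<open>\<nu> = 0\<close> thus moves with speed \<open>- a * d\<^sup>2 / J < 0\<close>. The proof
  makes this rigorous with sign changes and the intermediate value theorem.\<close>

lemma crossing_count:
  fixes f d :: "real \<Rightarrow> real \<Rightarrow> real" and J :: "real \<Rightarrow> real \<Rightarrow> real \<Rightarrow> real"
  assumes fc: "continuous_on UNIV (\<lambda>z. f (snd z) (fst z))"
    and Jc: "continuous_on UNIV (\<lambda>z. J (fst z) (fst (snd z)) (snd (snd z)))"
    and Jpos: "\<And>\<nu>. J a \<nu> \<nu> > 0"
    and ident: "\<And>r \<nu>1 \<nu>2. r > 0 \<Longrightarrow> d \<nu>2 r * f \<nu>1 r - d \<nu>1 r * f \<nu>2 r = (\<nu>2 - \<nu>1) * J r \<nu>1 \<nu>2"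
    and low: "\<And>\<nu> r. \<nu> \<le> - C \<Longrightarrow> f \<nu> r > 0"
    and a: "a > 0" and fa: "f 0 a = 0"
    and df: "(f 0 has_real_derivative - a * d 0 a) (at a)"
  shows "d 0 a \<noteq> 0 \<and> (\<exists>\<delta>>0. \<forall>t s. a < t \<and> t < a + \<delta> \<and> a - \<delta> < s \<and> s < a \<longrightarrow>
    card {\<nu>. \<nu> < 0 \<and> f \<nu> t = 0} = card {\<nu>. \<nu> < 0 \<and> f \<nu> s = 0} + 1)"
proof -
  have ft: "continuous_on A (\<lambda>t. f \<nu> t)" for \<nu> A
    by (rule continuous_on_compose2[OF fc, of A "\<lambda>t. (t, \<nu>)", simplified]) (intro continuous_intros)
  have fn: "continuous_on A (\<lambda>\<nu>. f \<nu> t)" for t A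
    by (rule continuous_on_compose2[OF fc, of A "\<lambda>\<nu>. (t, \<nu>)", simplified]) (intro continuous_intros)
  have C: "0 < C" using low[of 0 a] fa by (cases "0 \<le> - C") auto

  \<comment> \<open>The set where \<open>J\<close> is positive is open and contains
    \<open>(a, \<nu>0, \<nu>0)\<close>. A quarter of the radius is enough, since the distance of
    triples is at most the sum of the three coordinate distances.\<close>
  have "\<exists>e>0. \<forall>t \<nu>1 \<nu>2. \<bar>t - a\<bar> < e \<and> \<bar>\<nu>1 - \<nu>0\<bar> \<le> e \<and> \<bar>\<nu>2 - \<nu>0\<bar> \<le> e \<longrightarrow> J t \<nu>1 \<nu>2 > 0" for \<nu>0
  proof -
    have "open {z. 0 < J (fst z) (fst (snd z)) (snd (snd z))}"
      by (intro open_Collect_less Jc continuous_intros)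
    moreover have "(a, \<nu>0, \<nu>0) \<in> {z. 0 < J (fst z) (fst (snd z)) (snd (snd z))}" using Jpos by simp
    ultimately obtain \<rho> where \<rho>: "\<rho> > 0" "ball (a, \<nu>0, \<nu>0) \<rho> \<subseteq> {z. 0 < J (fst z) (fst (snd z)) (snd (snd z))}"
      by (meson open_contains_ball)
    have "J t \<nu>1 \<nu>2 > 0" if "\<bar>t - a\<bar> < \<rho> / 4" "\<bar>\<nu>1 - \<nu>0\<bar> \<le> \<rho> / 4" "\<bar>\<nu>2 - \<nu>0\<bar> \<le> \<rho> / 4" for t \<nu>1 \<nu>2
    proof -
      have "dist (a, \<nu>0, \<nu>0) (t, \<nu>1, \<nu>2) \<le> \<bar>dist a t\<bar> + \<bar>dist (\<nu>0, \<nu>0) (\<nu>1, \<nu>2)\<bar>"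
        unfolding dist_Pair_Pair[of a] by (rule sqrt_sum_squares_le_sum_abs)
      also have "\<bar>dist (\<nu>0, \<nu>0) (\<nu>1, \<nu>2)\<bar> \<le> \<bar>dist \<nu>0 \<nu>1\<bar> + \<bar>dist \<nu>0 \<nu>2\<bar>"
        unfolding dist_Pair_Pair abs_of_nonneg[OF real_sqrt_ge_zero[OF sum_power2_ge_zero]] by (rule sqrt_sum_squares_le_sum_abs)
      also have "\<bar>dist a t\<bar> + (\<bar>dist \<nu>0 \<nu>1\<bar> + \<bar>dist \<nu>0 \<nu>2\<bar>) < \<rho>"
        using that \<rho>(1) unfolding dist_real_def by linarith
      finally show ?thesis using \<rho>(2) by auto
    qed
    then show ?thesis using \<rho>(1) by (intro exI[of _ "\<rho> / 4"]) auto
  qed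
  then obtain e where e: "\<And>\<nu>0. e \<nu>0 > 0"
    and eJ: "\<And>\<nu>0 t \<nu>1 \<nu>2. \<bar>t - a\<bar> < e \<nu>0 \<Longrightarrow> \<bar>\<nu>1 - \<nu>0\<bar> \<le> e \<nu>0 \<Longrightarrow> \<bar>\<nu>2 - \<nu>0\<bar> \<le> e \<nu>0 \<Longrightarrow> J t \<nu>1 \<nu>2 > 0"
    by metis
  have uniq: "\<nu>1 = \<nu>2" if "\<bar>t - a\<bar> < e \<nu>0" "\<bar>\<nu>1 - \<nu>0\<bar> \<le> e \<nu>0" "\<bar>\<nu>2 - \<nu>0\<bar> \<le> e \<nu>0" "t > 0" "f \<nu>1 t = 0" "f \<nu>2 t = 0"
    for t \<nu>0 \<nu>1 \<nu>2
    using eJ[OF that(1-3)] ident[OF that(4), of \<nu>2 \<nu>1] that(5,6) by simp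

  \<comment> \<open>The point 0 is kept in \<open>Z\<close> although only negative parameters are
    counted: it is the zero that crosses.\<close>
  define Z where "Z = {\<nu> \<in> {-C..0}. f \<nu> a = 0}"
  have "finite Z"
  proof (rule ccontr)
    assume "infinite Z"
    moreover have "Z \<subseteq> {-C..0}" by (auto simp: Z_def)
    ultimately obtain \<nu>0 where "\<nu>0 islimpt Z"
      using compact_eq_Bolzano_Weierstrass[of "{-C..0}"] by auto
    then have lim: "\<And>\<epsilon>. \<epsilon> > 0 \<Longrightarrow> \<exists>\<nu>\<in>Z. \<nu> \<noteq> \<nu>0 \<and> dist \<nu> \<nu>0 < \<epsilon>" by (auto simp: islimpt_approachable)
    from lim[OF e[of \<nu>0]] obtain \<nu>1 where 1: "\<nu>1 \<in> Z" "\<nu>1 \<noteq> \<nu>0" "dist \<nu>1 \<nu>0 < e \<nu>0" by auto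
    from lim[of "dist \<nu>1 \<nu>0"] 1 obtain \<nu>2 where 2: "\<nu>2 \<in> Z" "dist \<nu>2 \<nu>0 < dist \<nu>1 \<nu>0" by auto
    have "\<nu>1 = \<nu>2"
      by (rule uniq[of a \<nu>0]) (use 1 2 e a in \<open>auto simp: Z_def dist_real_def\<close>)
    with 2 show False by simp
  qed
  have Z0: "0 \<in> Z" using C fa by (auto simp: Z_def)
  \<comment> \<open>At each zero \<open>f\<close> changes sign transversally:
    \<open>f (\<nu>0 + h) a\<close> has the sign of \<open>- h * d \<nu>0 a\<close>, and in
    particular \<open>d \<nu>0 a\<close> is nonzero.\<close>
  have dne: "d \<nu>0 a * f (\<nu>0 + h) a * h < 0" if "f \<nu>0 a = 0" "h \<noteq> 0" "\<bar>h\<bar> \<le> e \<nu>0" for \<nu>0 h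
  proof -
    have "J a \<nu>0 (\<nu>0 + h) > 0" by (rule eJ[of _ \<nu>0]) (use e that in \<open>auto simp: less_imp_le\<close>)
    moreover have "d \<nu>0 a * f (\<nu>0 + h) a = - (h * J a \<nu>0 (\<nu>0 + h))"
      using ident[OF a, of "\<nu>0 + h" \<nu>0] that by simp
    moreover have "h * h > 0" using that(2) by (auto simp: zero_less_mult_iff)
    ultimately have "0 < h * h * J a \<nu>0 (\<nu>0 + h)" "d \<nu>0 a * f (\<nu>0 + h) a * h = - (h * h * J a \<nu>0 (\<nu>0 + h))"
      by simp_all
    then show ?thesis by linarith
  qed
  have ev0: "\<forall>\<^sub>F E in at_right 0. 2 * E < c" if "c > 0" for c :: real
    by (rule eventually_mono[OF eventually_at_right_real[of 0 "c / 2"]]) (use that in auto)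
  have "\<forall>\<^sub>F E in at_right 0. \<forall>\<nu>\<in>Z. 2 * E < e \<nu> \<and> (\<forall>\<nu>'\<in>Z. \<nu>' \<noteq> \<nu> \<longrightarrow> 2 * E < \<bar>\<nu> - \<nu>'\<bar>)"
  proof (intro eventually_ball_finite \<open>finite Z\<close> ballI eventually_conj)
    fix \<nu> show "\<forall>\<^sub>F E in at_right 0. 2 * E < e \<nu>" by (rule ev0[OF e])
    fix \<nu>' show "\<forall>\<^sub>F E in at_right 0. \<nu>' \<noteq> \<nu> \<longrightarrow> 2 * E < \<bar>\<nu> - \<nu>'\<bar>"
      by (cases "\<nu>' = \<nu>") (auto intro: ev0)
  qed
  moreover have "\<forall>\<^sub>F E in at_right (0::real). E > 0" by (simp add: eventually_at_right_less)
  ultimately have "\<forall>\<^sub>F E in at_right 0. E > 0 \<and> (\<forall>\<nu>\<in>Z. 2 * E < e \<nu> \<and> (\<forall>\<nu>'\<in>Z. \<nu>' \<noteq> \<nu> \<longrightarrow> 2 * E < \<bar>\<nu> - \<nu>'\<bar>))"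
    by eventually_elim simp
  then obtain E where E: "E > 0" and Ee: "\<And>\<nu>. \<nu> \<in> Z \<Longrightarrow> 2 * E < e \<nu>"
    and Esep: "\<And>\<nu> \<nu>'. \<nu> \<in> Z \<Longrightarrow> \<nu>' \<in> Z \<Longrightarrow> \<nu>' \<noteq> \<nu> \<Longrightarrow> 2 * E < \<bar>\<nu> - \<nu>'\<bar>"
    using eventually_happens'[OF trivial_limit_at_right_real] by blast
  have Ee': "E \<le> e \<nu>" if "\<nu> \<in> Z" for \<nu> using Ee[OF that] E by simp

  \<comment> \<open>On this compact remainder \<open>f\<close> has no zero at \<open>t = a\<close>.
    The tube lemma preserves that for nearby \<open>t\<close>, so no zero can appear away from
    \<open>Z\<close>.\<close>
  define K where "K = {-C..0} - (\<Union>\<nu>\<in>Z. ball \<nu> E)"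
  have "compact K" unfolding K_def by (intro compact_diff compact_Icc open_UN ballI open_ball)
  have W1: "open {z. f (snd z) (fst z) \<noteq> 0}" by (intro open_Collect_neq fc continuous_intros)
  have W2: "{a} \<times> K \<subseteq> {z. f (snd z) (fst z) \<noteq> 0}"
    using E by (auto simp: K_def Z_def)
  obtain X where X: "a \<in> X" "open X" "X \<times> K \<subseteq> {z. f (snd z) (fst z) \<noteq> 0}"
    using Elementary_Topology.tube_lemma[OF \<open>compact K\<close> W1 W2] by blast
  have evX: "\<forall>\<^sub>F t in nhds a. t \<in> X" using X by (intro eventually_nhds_in_open)
  have evt: "\<forall>\<^sub>F t in nhds a. 0 < g t" if "continuous_on UNIV g" "0 < g a" for g :: "real \<Rightarrow> real"
  proof -
    have "isCont g a" using that(1) by (simp add: continuous_on_eq_continuous_at)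
    then have "(g \<longlongrightarrow> g a) (nhds a)" by (simp add: isCont_def tendsto_at_iff_tendsto_nhds)
    then show ?thesis using that(2) by (rule order_tendstoD)
  qed
  have evn: "\<forall>\<^sub>F t in nhds a. \<forall>\<nu>\<in>Z. 0 < d \<nu> a * f (\<nu> - E) t \<and> 0 < - (d \<nu> a * f (\<nu> + E) t) \<and> 0 < e \<nu> - \<bar>t - a\<bar> \<and> 0 < t"
    using \<open>finite Z\<close>
  proof (intro eventually_ball_finite ballI eventually_conj evt continuous_intros ft)
    fix \<nu> assume \<nu>: "\<nu> \<in> Z"
    then have "f \<nu> a = 0" by (simp add: Z_def)
    from dne[OF this, of "- E"] dne[OF this, of E] E Ee'[OF \<nu>]
    show "0 < d \<nu> a * f (\<nu> - E) a" "0 < - (d \<nu> a * f (\<nu> + E) a)" by (auto simp: zero_less_mult_iff mult_less_0_iff)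
    show "0 < e \<nu> - \<bar>a - a\<bar>" "0 < a" using e a by auto
  qed
  \<comment> \<open>Multiplication by \<open>d 0 a\<close> makes the derivative
    \<open>- a * (d 0 a)\<^sup>2\<close>, negative whatever the sign of the slope.\<close>
  have dd: "((\<lambda>t. d 0 a * f 0 t) has_real_derivative d 0 a * (- a * d 0 a)) (at a)"
    by (intro DERIV_cmult df)
  have d0: "d 0 a \<noteq> 0" using dne[OF fa, of E] E Ee'[OF Z0] by auto
  then have neg: "d 0 a * (- a * d 0 a) < 0" using a by (simp add: mult_less_0_iff zero_less_mult_iff) (metis linorder_neqE_linordered_idom)
  obtain \<delta>1 where \<delta>1: "\<delta>1 > 0" "\<And>h. 0 < h \<Longrightarrow> h < \<delta>1 \<Longrightarrow> d 0 a * f 0 (a + h) < 0"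
    using DERIV_neg_dec_right[OF dd neg] fa by auto
  obtain \<delta>2 where \<delta>2: "\<delta>2 > 0" "\<And>h. 0 < h \<Longrightarrow> h < \<delta>2 \<Longrightarrow> 0 < d 0 a * f 0 (a - h)"
    using DERIV_neg_dec_left[OF dd neg] fa by auto
  from eventually_conj[OF evX evn] obtain \<delta>3 where \<delta>3: "\<delta>3 > 0" and
    G: "\<And>t. dist t a < \<delta>3 \<Longrightarrow> t \<in> X \<and> (\<forall>\<nu>\<in>Z. 0 < d \<nu> a * f (\<nu> - E) t \<and> 0 < - (d \<nu> a * f (\<nu> + E) t) \<and> 0 < e \<nu> - \<bar>t - a\<bar> \<and> 0 < t)"
    unfolding eventually_nhds_metric by blast

  define B where "B t \<nu>0 = {\<nu> \<in> ball \<nu>0 E. \<nu> < 0 \<and> f \<nu> t = 0}" for t \<nu>0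
  have ivt: "\<exists>\<nu>. x < \<nu> \<and> \<nu> < y \<and> f \<nu> t = 0" if "x < y" "0 < c * f x t" "c * f y t < 0" for c x y t
  proof -
    have "\<exists>\<nu>\<ge>x. \<nu> \<le> y \<and> c * f \<nu> t = 0"
      by (rule IVT2') (use that in \<open>auto intro!: continuous_intros fn\<close>)
    then obtain \<nu> where "x \<le> \<nu>" "\<nu> \<le> y" "c * f \<nu> t = 0" by auto
    moreover have "c \<noteq> 0" "\<nu> \<noteq> x" "\<nu> \<noteq> y" using that calculation by auto
    ultimately show ?thesis by (intro exI[of _ \<nu>]) auto
  qed
  have Bcard: "card (B t \<nu>0) = 1" if "\<nu>0 \<in> Z" "t > 0" "\<bar>t - a\<bar> < e \<nu>0" "\<nu> \<in> B t \<nu>0" for t \<nu>0 \<nu>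
  proof -
    have "B t \<nu>0 = {\<nu>}"
    proof (rule equalityI[OF subsetI])
      fix x assume "x \<in> B t \<nu>0"
      then have "f x t = 0" "\<bar>x - \<nu>0\<bar> < E" "f \<nu> t = 0" "\<bar>\<nu> - \<nu>0\<bar> < E"
        using that(4) by (simp_all add: B_def dist_real_def abs_minus_commute)
      moreover from this have "\<bar>x - \<nu>0\<bar> \<le> e \<nu>0" "\<bar>\<nu> - \<nu>0\<bar> \<le> e \<nu>0"
        using Ee'[OF that(1)] by linarith+
      ultimately have "x = \<nu>" using uniq[OF that(3) _ _ that(2)] by blast
      then show "x \<in> {\<nu>}" by simp
    qed (use that in auto)
    then show ?thesis by simp
  qed
  \<comment> \<open>Separation from the element 0 of \<open>Z\<close> keeps the whole ball around
    any other zero on the negative side, so its single zero is counted before and after the turn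
    alike.\<close>
  have neg0: "\<nu>0 + E < 0" if "\<nu>0 \<in> Z" "\<nu>0 \<noteq> 0" for \<nu>0
    using Esep[OF that(1) Z0] that E by (auto simp: Z_def)
  have Bother: "card (B t \<nu>0) = 1" if t: "dist t a < \<delta>3" and \<nu>0: "\<nu>0 \<in> Z" "\<nu>0 \<noteq> 0" for t \<nu>0
  proof -
    have g: "0 < d \<nu>0 a * f (\<nu>0 - E) t" "0 < - (d \<nu>0 a * f (\<nu>0 + E) t)" "\<bar>t - a\<bar> < e \<nu>0" "0 < t"
      using G[OF t] \<nu>0(1) by auto
    obtain \<nu> where "\<nu>0 - E < \<nu>" "\<nu> < \<nu>0 + E" "f \<nu> t = 0" using ivt[of "\<nu>0 - E" "\<nu>0 + E" "d \<nu>0 a" t] g E by auto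
    then have "\<nu> \<in> B t \<nu>0" using neg0[OF \<nu>0] by (auto simp: B_def dist_real_def)
    then show ?thesis using Bcard \<nu>0 g by blast
  qed
  have count: "card {\<nu>. \<nu> < 0 \<and> f \<nu> t = 0} = card (Z - {0}) + card (B t 0)" if t: "dist t a < \<delta>3" for t
  proof -
    have tt: "t > 0" "\<And>\<nu>. \<nu> \<in> Z \<Longrightarrow> \<bar>t - a\<bar> < e \<nu>" using G[OF t] Z0 by auto
    have "{\<nu>. \<nu> < 0 \<and> f \<nu> t = 0} = (\<Union>\<nu>0\<in>Z. B t \<nu>0)"
    proof (rule equalityI[OF subsetI])
      fix \<nu> assume \<nu>: "\<nu> \<in> {\<nu>. \<nu> < 0 \<and> f \<nu> t = 0}"
      then have "\<nu> > - C" using low[of \<nu> t] by (cases "\<nu> \<le> - C") auto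
      moreover have "\<nu> \<notin> K" using X(3) G[OF t] \<nu> by auto
      ultimately show "\<nu> \<in> (\<Union>\<nu>0\<in>Z. B t \<nu>0)" using \<nu> by (auto simp: K_def B_def)
    qed (auto simp: B_def)
    also have "card \<dots> = (\<Sum>\<nu>0\<in>Z. card (B t \<nu>0))"
    proof (rule card_UN_disjoint[OF \<open>finite Z\<close>])
      show "\<forall>\<nu>0\<in>Z. finite (B t \<nu>0)"
      proof
        fix \<nu>0 assume "\<nu>0 \<in> Z"
        show "finite (B t \<nu>0)"
        proof (cases "B t \<nu>0 = {}")
          case False
          then show ?thesis using Bcard[OF \<open>\<nu>0 \<in> Z\<close> tt(1) tt(2)[OF \<open>\<nu>0 \<in> Z\<close>]]
            by (intro card_ge_0_finite) auto
        qed simp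
      qed
      show "\<forall>i\<in>Z. \<forall>j\<in>Z. i \<noteq> j \<longrightarrow> B t i \<inter> B t j = {}"
      proof (intro ballI impI)
        fix i j assume ij: "i \<in> Z" "j \<in> Z" "i \<noteq> j"
        have "2 * E < \<bar>i - j\<bar>" using Esep[of i j] ij by auto
        then show "B t i \<inter> B t j = {}" by (auto simp: B_def dist_real_def)
      qed
    qed
    also have "\<dots> = card (B t 0) + (\<Sum>\<nu>0\<in>Z - {0}. card (B t \<nu>0))"
      by (rule sum.remove[OF \<open>finite Z\<close> Z0])
    also have "(\<Sum>\<nu>0\<in>Z - {0}. card (B t \<nu>0)) = (\<Sum>\<nu>0\<in>Z - {0}. 1)"
      by (intro sum.cong refl Bother[OF t]) auto
    finally show ?thesis by simp
  qed
  define \<delta> where "\<delta> = min \<delta>1 (min \<delta>2 \<delta>3)"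
  \<comment> \<open>After the turn \<open>d 0 a * f 0 t\<close> is negative while the value at
    \<open>- E\<close> is still positive, so the zero lies strictly below 0.\<close>
  have right: "card (B t 0) = 1" if "a < t" "t < a + \<delta>" for t
  proof -
    have t: "dist t a < \<delta>3" using that by (auto simp: \<delta>_def dist_real_def)
    have "d 0 a * f 0 t < 0" using \<delta>1(2)[of "t - a"] that by (auto simp: \<delta>_def)
    moreover have "0 < d 0 a * f (- E) t" using G[OF t] Z0 by auto
    ultimately obtain \<nu> where "- E < \<nu>" "\<nu> < 0" "f \<nu> t = 0" using ivt[of "- E" 0] E by auto
    then have "\<nu> \<in> B t 0" by (auto simp: B_def)
    then show ?thesis using Bcard[OF Z0] G[OF t] Z0 by auto
  qed
  \<comment> \<open>Before the turn the sign change takes place between 0 and \<open>E\<close>; as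
    the ball holds only one zero, none is negative.\<close>
  have left: "card (B s 0) = 0" if "a - \<delta> < s" "s < a" for s
  proof -
    have s: "dist s a < \<delta>3" using that by (auto simp: \<delta>_def dist_real_def)
    have "0 < d 0 a * f 0 s" using \<delta>2(2)[of "a - s"] that by (auto simp: \<delta>_def)
    moreover have "d 0 a * f E s < 0" using G[OF s] Z0 by auto
    ultimately obtain \<nu> where \<nu>: "0 < \<nu>" "\<nu> < E" "f \<nu> s = 0" using ivt[of 0 E] E by auto
    have "B s 0 = {}"
    proof (rule equals0I)
      fix x assume "x \<in> B s 0"
      then have x: "f x s = 0" "\<bar>x\<bar> < E" by (auto simp: B_def)
      have "0 < e 0 - \<bar>s - a\<bar>" "0 < s" using G[OF s] Z0 by auto
      with x \<nu> Ee'[OF Z0] have "x = \<nu>" using uniq[of s 0 x \<nu>] by simp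
      with \<open>x \<in> B s 0\<close> \<nu> show False by (auto simp: B_def)
    qed
    then show ?thesis by simp
  qed
  show ?thesis
  proof (intro exI[of _ \<delta>] conjI allI impI d0)
    show "\<delta> > 0" using \<delta>1 \<delta>2 \<delta>3 by (simp add: \<delta>_def)
    fix t s assume ts: "a < t \<and> t < a + \<delta> \<and> a - \<delta> < s \<and> s < a"
    then have "dist t a < \<delta>3" "dist s a < \<delta>3" by (auto simp: \<delta>_def dist_real_def)
    then show "card {\<nu>. \<nu> < 0 \<and> f \<nu> t = 0} = card {\<nu>. \<nu> < 0 \<and> f \<nu> s = 0} + 1"
      using count right left ts by simp
  qed
qed

section \<open>The profile and its linearisation\<close>

lemma tendsto_at_right_0: "continuous_on UNIV (g :: real \<Rightarrow> real) \<Longrightarrow> (g \<longlongrightarrow> g 0) (at_right 0)"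
  by (metis continuous_on_eq_continuous_at continuous_at_imp_continuous_at_within continuous_within open_UNIV UNIV_I)

text \<open>The energy \<open>f\<^sup>2 + g\<^sup>2\<close>, damped by
  \<open>exp (- (1 + K) * r)\<close>, is nonincreasing: the singular coefficient
  \<open>m / r\<close> acts as friction and contributes \<open>- 2 * m / r * g\<^sup>2\<close>.
  Since the energy tends to 0 at the origin, it vanishes.\<close>

lemma radial_ode_unique:
  fixes f g Q :: "real \<Rightarrow> real"
  assumes d: "\<And>r. 0 < r \<Longrightarrow> r < R \<Longrightarrow> (f has_real_derivative g r) (at r)"
    and d1: "\<And>r. 0 < r \<Longrightarrow> r < R \<Longrightarrow> (g has_real_derivative - (real m / r * g r) - Q r * f r) (at r)"
    and Q: "\<And>r. 0 < r \<Longrightarrow> r < R \<Longrightarrow> \<bar>Q r\<bar> \<le> K"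
    and lim: "(f \<longlongrightarrow> 0) (at_right 0)" "(g \<longlongrightarrow> 0) (at_right 0)"
    and r: "0 < r" "r < R"
  shows "f r = 0"
proof -
  let ?E = "\<lambda>r. ((f r)\<^sup>2 + (g r)\<^sup>2) * exp (- (1 + K) * r)"
  let ?D = "\<lambda>r. (2 * f r * g r + 2 * g r * (- (real m / r * g r) - Q r * f r) - (1 + K) * ((f r)\<^sup>2 + (g r)\<^sup>2)) * exp (- (1 + K) * r)"
  have dE: "(?E has_real_derivative ?D x) (at x)" if "0 < x" "x < R" for x
    using that by (auto intro!: derivative_eq_intros d d1 simp: algebra_simps)
  have D: "?D x \<le> 0" if x: "0 < x" "x < R" for x
  proof -
    have "2 * f x * g x * (1 - Q x) \<le> \<bar>2 * f x * g x\<bar> * \<bar>1 - Q x\<bar>"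
      by (metis abs_ge_self abs_mult)
    also have "\<dots> \<le> ((f x)\<^sup>2 + (g x)\<^sup>2) * (1 + K)"
    proof (rule mult_mono)
      show "\<bar>2 * f x * g x\<bar> \<le> (f x)\<^sup>2 + (g x)\<^sup>2"
        using sum_squares_bound[of "\<bar>f x\<bar>" "\<bar>g x\<bar>"] by (simp add: abs_mult)
      show "\<bar>1 - Q x\<bar> \<le> 1 + K" using Q[OF x] by linarith
    qed auto
    moreover have "0 \<le> real m / x * (g x)\<^sup>2" using x by simp
    moreover have "2 * f x * g x + 2 * g x * (- (real m / x * g x) - Q x * f x) - (1 + K) * ((f x)\<^sup>2 + (g x)\<^sup>2)
      = 2 * f x * g x * (1 - Q x) - 2 * (real m / x * (g x)\<^sup>2) - ((f x)\<^sup>2 + (g x)\<^sup>2) * (1 + K)"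
      by (simp add: algebra_simps power2_eq_square)
    ultimately have "2 * f x * g x + 2 * g x * (- (real m / x * g x) - Q x * f x) - (1 + K) * ((f x)\<^sup>2 + (g x)\<^sup>2) \<le> 0"
      by linarith
    then show ?thesis by (simp add: mult_nonpos_nonneg)
  qed
  have dec: "?E r \<le> ?E s" if "0 < s" "s < r" for s
  proof (rule DERIV_nonpos_imp_nonincreasing[of s r ?E])
    fix x assume "s \<le> x" "x \<le> r"
    then have "0 < x" "x < R" using that r by auto
    then show "\<exists>y. (?E has_real_derivative y) (at x) \<and> y \<le> 0" using dE D by blast
  qed (use that in simp)
  have "(?E \<longlongrightarrow> (0\<^sup>2 + 0\<^sup>2) * exp (- (1 + K) * 0)) (at_right 0)"
    by (intro tendsto_intros lim)
  moreover have "\<forall>\<^sub>F s in at_right 0. ?E r \<le> ?E s"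
    using eventually_at_right_real[OF r(1)] by eventually_elim (use dec in auto)
  ultimately have "?E r \<le> (0\<^sup>2 + 0\<^sup>2) * exp (- (1 + K) * 0)"
    by (rule tendsto_lowerbound) simp
  then have "(f r)\<^sup>2 + (g r)\<^sup>2 \<le> 0" by (simp add: mult_le_0_iff)
  then show ?thesis by (simp add: sum_power2_le_zero_iff)
qed

locale mems =
  fixes m :: nat and p :: real and w w' :: "real \<Rightarrow> real"
  assumes p: "p > 0" and w0: "w 0 = 1" and w_pos: "\<And>t. t \<ge> 0 \<Longrightarrow> w t > 0"
    and dw0: "(w has_real_derivative 0) (at_right 0)" and w_right: "continuous (at_right 0) w"
    and dw: "\<And>t. t > 0 \<Longrightarrow> (w has_real_derivative w' t) (at t)"
    and dw': "\<And>t. t > 0 \<Longrightarrow> (w' has_real_derivative 1 / (w t powr p) - real m / t * w' t) (at t)"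
begin

text \<open>The profile is controlled only for nonnegative arguments; the even extension gives the
  functions on the whole line that the averages and the Picard series work with.\<close>

definition src :: "real \<Rightarrow> real" where "src r = 1 / (w \<bar>r\<bar> powr p)"
definition q :: "real \<Rightarrow> real" where "q r = p / (w \<bar>r\<bar> powr (p + 1))"
text \<open>This will turn out to be \<open>w' r / r\<close>, in a form that is continuous and
  positive at the origin too.\<close>

definition b :: "real \<Rightarrow> real" where "b = avg m src"

lemma w_cont: "continuous_on {0..} w"
  unfolding continuous_on_eq_continuous_within
proof
  fix t :: real assume t: "t \<in> {0..}"
  show "continuous (at t within {0..}) w"
  proof (cases "t = 0")
    case True
    have "(w \<longlongrightarrow> w 0) (at_right 0)" using w_right by (simp add: continuous_within)
    then have "(w \<longlongrightarrow> w 0) (at 0 within {0..})"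
      by (simp add: at_within_Ici_at_right)
    then show ?thesis using True by (simp add: continuous_within)
  next
    case False
    then show ?thesis using t DERIV_isCont[OF dw, of t] by (simp add: continuous_at_imp_continuous_at_within)
  qed
qed

lemma w_abs_cont: "continuous_on A (\<lambda>r. w \<bar>r\<bar>)"
  by (rule continuous_on_compose2[OF w_cont]) (auto intro!: continuous_intros)

lemma w_abs_pos: "w \<bar>r\<bar> > 0" using w_pos by simp

lemma w_abs_ne: "w \<bar>r\<bar> \<noteq> 0" using w_abs_pos[of r] by simp

lemma src_cont: "continuous_on UNIV src"
  unfolding src_def[abs_def] by (intro continuous_intros w_abs_cont) (simp_all add: w_abs_ne)

lemma src_pos: "src r > 0" using w_abs_pos[of r] by (simp add: src_def)

lemma b_cont: "continuous_on UNIV b" unfolding b_def by (rule continuous_on_avg[OF src_cont])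

lemma b_pos: "b r > 0" unfolding b_def by (rule avg_pos[OF src_cont]) (auto intro: less_imp_le src_pos)

lemma DERIV_b: "r > 0 \<Longrightarrow> (b has_real_derivative (src r - real (Suc m) * b r) / r) (at r)"
  unfolding b_def by (rule DERIV_avg[OF src_cont])

text \<open>The singular solution \<open>c / r ^ m\<close> of \<open>(r ^ m * w')' = 0\<close> is excluded by
  \<open>(w r - 1) / r \<rightarrow> 0\<close> and the mean value theorem.\<close>
lemma w'_eq: assumes "r > 0" shows "w' r = r * b r"
proof -
  let ?F = "\<lambda>r. r ^ m * w' r - r ^ Suc m * b r"
  have "\<exists>c. \<forall>x\<in>{0<..}. ?F x = c"
  proof (rule has_field_derivative_zero_constant)
    fix x :: real assume "x \<in> {0<..}"
    then have x: "x > 0" by simp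
    have "(?F has_real_derivative (real m / x * x ^ m) * w' x + (1 / (w x powr p) - real m / x * w' x) * x ^ m - x ^ m * src x) (at x)"
      unfolding b_def
      by (intro derivative_intros DERIV_mpower DERIV_power_avg[OF src_cont] dw' x)
    moreover have "(real m / x * x ^ m) * w' x + (1 / (w x powr p) - real m / x * w' x) * x ^ m - x ^ m * src x = 0"
      using x by (simp add: src_def algebra_simps)
    ultimately have "(?F has_real_derivative 0) (at x)" by simp
    then show "(?F has_real_derivative 0) (at x within {0<..})" by (rule has_field_derivative_at_within)
  qed (rule convex_real_interval)
  then obtain c where c: "\<And>x. x > 0 \<Longrightarrow> ?F x = c" by auto
  have "\<exists>\<xi>. 0 < \<xi> \<and> \<xi> < x \<and> w' \<xi> = (w x - 1) / x" if "x > 0" for x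
  proof -
    have "\<exists>l z. 0 < z \<and> z < x \<and> (w has_real_derivative l) (at z) \<and> w x - w 0 = (x - 0) * l"
      by (rule MVT) (use that dw w_cont in \<open>auto intro: continuous_on_subset simp: real_differentiable_def\<close>)
    then obtain l z where lz: "0 < z" "z < x" "(w has_real_derivative l) (at z)" "w x - 1 = x * l"
      using w0 by auto
    moreover have "l = w' z" using DERIV_unique[OF lz(3) dw[OF lz(1)]] .
    ultimately show ?thesis using that by (intro exI[of _ z]) auto
  qed
  then obtain \<xi> where \<xi>: "\<And>x. x > 0 \<Longrightarrow> 0 < \<xi> x" "\<And>x. x > 0 \<Longrightarrow> \<xi> x < x" "\<And>x. x > 0 \<Longrightarrow> w' (\<xi> x) = (w x - 1) / x"
    by metis
  have ev: "\<forall>\<^sub>F x in at_right (0::real). 0 < x \<and> x < 1" using eventually_at_right_real[of 0 1] by simp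
  have l1: "((\<lambda>x. (w x - 1) / x) \<longlongrightarrow> 0) (at_right 0)"
    using dw0 by (simp add: has_field_derivative_iff w0)
  have l\<xi>: "(\<xi> \<longlongrightarrow> 0) (at_right 0)"
    by (rule tendsto_sandwich[of "\<lambda>_. 0" _ _ "\<lambda>x. x"])
      (use ev \<xi> in \<open>auto elim!: eventually_mono intro: less_imp_le tendsto_ident_at\<close>)
  have l2: "((\<lambda>x. \<xi> x ^ m * w' (\<xi> x)) \<longlongrightarrow> 0) (at_right 0)"
  proof (rule Lim_null_comparison[OF _ tendsto_norm_zero[OF l1]])
    show "\<forall>\<^sub>F x in at_right 0. norm (\<xi> x ^ m * w' (\<xi> x)) \<le> norm ((w x - 1) / x)"
      using ev
    proof eventually_elim
      case (elim x)
      then have "\<bar>\<xi> x ^ m\<bar> \<le> 1" using \<xi>(1,2)[of x] by (auto intro: power_le_one)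
      then have "\<bar>\<xi> x ^ m\<bar> * \<bar>w' (\<xi> x)\<bar> \<le> 1 * \<bar>w' (\<xi> x)\<bar>" by (rule mult_right_mono) simp
      then show ?case using \<xi>(3)[of x] elim by (simp add: abs_mult)
    qed
  qed
  have "isCont b 0" using b_cont by (simp add: continuous_on_eq_continuous_at)
  then have "((\<lambda>x. b (\<xi> x)) \<longlongrightarrow> b 0) (at_right 0)" by (rule isCont_tendsto_compose[OF _ l\<xi>])
  then have "((\<lambda>x. ?F (\<xi> x)) \<longlongrightarrow> 0 - 0 ^ Suc m * b 0) (at_right 0)"
    by (intro tendsto_intros l2 l\<xi>)
  moreover have "\<forall>\<^sub>F x in at_right 0. ?F (\<xi> x) = c" using ev by eventually_elim (use c \<xi> in blast)
  ultimately have "((\<lambda>x. c) \<longlongrightarrow> 0) (at_right (0::real))"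
    by (simp add: tendsto_cong)
  then have "c = 0" by (simp add: tendsto_const_iff)
  then have "r ^ m * w' r = r ^ m * (r * b r)" using c[OF assms] by simp
  then show ?thesis using assms by simp
qed

lemma DERIV_w: "r > 0 \<Longrightarrow> (w has_real_derivative r * b r) (at r)"
  using dw[of r] w'_eq[of r] by simp

lemma w_ge_1: assumes "r \<ge> 0" shows "w r \<ge> 1"
proof -
  have "w 0 \<le> w r"
  proof (rule DERIV_nonneg_imp_increasing_open[OF assms])
    show "continuous_on {0..r} w" by (rule continuous_on_subset[OF w_cont]) simp
    fix x assume x: "0 < x" "x < r"
    have "0 \<le> x * b x" using x b_pos[of x] by simp
    then show "\<exists>y. (w has_real_derivative y) (at x) \<and> 0 \<le> y" using DERIV_w x by blast
  qed
  then show ?thesis by (simp add: w0)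
qed

lemma q_cont: "continuous_on UNIV q"
  unfolding q_def[abs_def] by (intro continuous_intros w_abs_cont) (simp_all add: w_abs_ne)

lemma q_pos: "q r > 0" using p w_abs_pos[of r] by (simp add: q_def)

lemma q_le: "q r \<le> p"
proof -
  have "1 \<le> w \<bar>r\<bar> powr (p + 1)" using w_ge_1[of "\<bar>r\<bar>"] p by (intro ge_one_powr_ge_zero) auto
  then show ?thesis using p by (simp add: q_def divide_le_eq mult_le_cancel_left1)
qed

text \<open>Homogeneity of the nonlinearity: this relation absorbs the source term when the scaling
  family of profiles is differentiated.\<close>

lemma src_q: "r \<ge> 0 \<Longrightarrow> p * src r = q r * w r"
  using w_pos[of r] by (simp add: src_def q_def powr_add)

lemma DERIV_src: assumes "r > 0" shows "(src has_real_derivative - q r * (r * b r)) (at r)"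
proof -
  have "((\<lambda>r. w r powr (- p)) has_real_derivative (- p) * w r powr (- p - 1) * (r * b r)) (at r)"
    by (rule DERIV_cong[OF DERIV_fun_powr[OF DERIV_w[OF assms]]]) (use w_pos[of r] assms in auto)
  moreover have "(- p) * w r powr (- p - 1) * (r * b r) = - q r * (r * b r)"
    using assms w_pos[of r] powr_minus_divide[of "w r" "p + 1"] by (simp add: q_def)
  moreover have "\<forall>\<^sub>F x in nhds r. src x = w x powr (- p)"
    by (intro eventually_nhds_pos assms) (simp add: src_def powr_minus_divide)
  ultimately show ?thesis by (subst DERIV_cong_ev[OF refl _ refl]) auto
qed

sublocale radial_schroedinger m q p
  by unfold_locales (use q_cont q_pos q_le less_imp_le in auto)

text \<open>The derivative at \<open>a = 1\<close> of the family \<open>a * w (a powr (- (p + 1) / 2) * r)\<close> of solutions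
  of the profile equation, hence a solution of the linearised equation.\<close>
definition phi :: "real \<Rightarrow> real" where "phi r = w \<bar>r\<bar> - (p + 1) / 2 * (r\<^sup>2 * b r)"

text \<open>This is \<open>- phi' / r\<close>, with the derivative of \<open>b\<close> replaced
  through its own equation so that no quotient by \<open>r\<close> remains.\<close>

definition phi_slope :: "real \<Rightarrow> real" where
  "phi_slope r = (p + 1) / 2 * (2 * b r + src r - real (Suc m) * b r) - b r"

lemma DERIV_phi: assumes "r > 0" shows "(phi has_real_derivative - r * phi_slope r) (at r)"
proof -
  have "((\<lambda>r. w r - (p + 1) / 2 * (r\<^sup>2 * b r)) has_real_derivative - r * phi_slope r) (at r)"
    by (rule derivative_eq_intros DERIV_w DERIV_b assms refl)+
      (use assms in \<open>simp add: phi_slope_def field_simps power2_eq_square\<close>)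
  moreover have "\<forall>\<^sub>F x in nhds r. phi x = w x - (p + 1) / 2 * (x\<^sup>2 * b x)"
    by (intro eventually_nhds_pos assms) (simp add: phi_def)
  ultimately show ?thesis by (subst DERIV_cong_ev[OF refl _ refl]) auto
qed

lemma DERIV_phi_slope: assumes "r > 0"
  shows "(phi_slope has_real_derivative (q r * phi r - real (Suc m) * phi_slope r) / r) (at r)"
proof -
  let ?n = "real (Suc m)" and ?k = "(p + 1) / 2"
  let ?b' = "(src r - ?n * b r) / r"
  have "(phi_slope has_real_derivative ?k * (2 * ?b' + (- q r * (r * b r)) - ?n * ?b') - ?b') (at r)"
    unfolding phi_slope_def[abs_def]
    by (intro DERIV_diff DERIV_add DERIV_cmult DERIV_b DERIV_src assms)
  moreover have "?k * (2 * ?b' + (- q r * (r * b r)) - ?n * ?b') - ?b' = (q r * phi r - ?n * phi_slope r) / r"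
  proof -
    have "r * (?k * (2 * ?b' + (- q r * (r * b r)) - ?n * ?b') - ?b')
      = ?k * ((2 - ?n) * (src r - ?n * b r) - q r * r\<^sup>2 * b r) - (src r - ?n * b r)"
      using assms by (simp add: field_simps power2_eq_square)
    also have "\<dots> = p * src r - ?k * (q r * (r\<^sup>2 * b r)) - ?n * phi_slope r"
      unfolding phi_slope_def by (simp add: field_simps)
    also have "\<dots> = q r * phi r - ?n * phi_slope r"
      using assms by (simp add: src_q phi_def algebra_simps)
    finally show ?thesis using assms by (simp add: eq_divide_eq mult.commute)
  qed
  ultimately show ?thesis by simp
qed

lemma phi_cont: "continuous_on UNIV phi"
  unfolding phi_def[abs_def] by (intro continuous_intros w_abs_cont b_cont)

lemma phi_slope_cont: "continuous_on UNIV phi_slope"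
  unfolding phi_slope_def[abs_def] by (intro continuous_intros src_cont b_cont)

text \<open>Both functions solve the radial equation at \<open>\<nu> = 0\<close>, take the value 1
  at the origin and have derivatives tending to 0 there, so the difference falls under the
  uniqueness lemma.\<close>

lemma phi_eq_sol: assumes "r > 0" shows "phi r = sol 0 r"
proof -
  let ?f = "\<lambda>r. phi r - sol 0 r" and ?f1 = "\<lambda>r. - r * (phi_slope r - sol_slope 0 r)"
  have "?f r = 0"
  proof (rule radial_ode_unique[where f = ?f and g = ?f1 and R = "r + 1" and m = m and Q = q and K = p])
    fix x assume x: "0 < x" "x < r + 1"
    show "(?f has_real_derivative ?f1 x) (at x)"
      by (rule derivative_eq_intros DERIV_phi DERIV_sol x refl)+ (simp add: algebra_simps)
    show "(?f1 has_real_derivative - (real m / x * ?f1 x) - q x * ?f x) (at x)"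
      by (rule derivative_eq_intros DERIV_phi_slope DERIV_sol_slope x refl)+ (use x in \<open>simp add: field_simps\<close>)
    show "\<bar>q x\<bar> \<le> p" using q_pos[of x] q_le[of x] by simp
  next
    have "continuous_on UNIV ?f" "continuous_on UNIV ?f1"
      by (intro continuous_intros phi_cont sol_cont1 phi_slope_cont sol_slope_cont)+
    from this[THEN tendsto_at_right_0] show "(?f \<longlongrightarrow> 0) (at_right 0)" "(?f1 \<longlongrightarrow> 0) (at_right 0)"
      by (simp_all add: phi_def sol_0 w0)
  qed (use assms in auto)
  then show ?thesis by simp
qed

lemma DERIV_lambda: assumes "t > 0"
  shows "(mems_lambda p w has_real_derivative 2 * t / w t powr (p + 2) * phi t) (at t)"
proof -
  have w: "w t > 0" using w_pos assms by simp
  have "((\<lambda>t. w t powr (p + 1)) has_real_derivative (p + 1) * w t powr (p + 1 - 1) * (t * b t)) (at t)"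
    by (rule DERIV_cong[OF DERIV_fun_powr[OF DERIV_w[OF assms] w]]) simp
  then have "((\<lambda>t. t\<^sup>2 / w t powr (p + 1)) has_real_derivative
      (2 * t * w t powr (p + 1) - t\<^sup>2 * ((p + 1) * w t powr (p + 1 - 1) * (t * b t))) / (w t powr (p + 1) * w t powr (p + 1))) (at t)"
    by (intro DERIV_divide) (use w in \<open>auto intro!: derivative_eq_intros\<close>)
  moreover have "(2 * t * w t powr (p + 1) - t\<^sup>2 * ((p + 1) * w t powr (p + 1 - 1) * (t * b t))) / (w t powr (p + 1) * w t powr (p + 1))
     = 2 * t / w t powr (p + 2) * phi t"
    using w assms by (simp add: phi_def powr_add divide_simps) (simp add: algebra_simps power2_eq_square)
  ultimately show ?thesis by (simp add: mems_lambda_def[abs_def])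
qed

lemma potential_eq: assumes "t > 0"
  shows "mems_potential p w t = (\<lambda>x. t\<^sup>2 * q (t * norm x))"
proof
  fix x :: "real ^ 'n"
  have w: "w t > 0" "w (t * norm x) > 0" using w_pos assms by auto
  show "mems_potential p w t x = t\<^sup>2 * q (t * norm x)"
    using w assms by (simp add: mems_potential_def mems_lambda_def mems_u_def q_def powr_divide abs_mult field_simps)
qed

text \<open>An infinite set would get cardinality 0. Near a turn this does not happen:
  \<open>crossing_count\<close> exhibits the set as a finite union of sets with at most one
  element.\<close>

definition neg_count :: "real \<Rightarrow> nat" where "neg_count t = card {\<nu>. \<nu> < 0 \<and> sol \<nu> t = 0}"

text \<open>As \<open>\<lambda>'\<close> is a nonzero factor times \<open>phi\<close> and
  \<open>phi a = 0\<close>, the product rule leaves in \<open>\<lambda>''\<close> only that factor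
  times \<open>phi' a = - a * sol_slope 0 a\<close>. The same nonvanishing slope drives the
  crossing.\<close>

lemma turning_point:
  assumes a: "a > 0" and l: "deriv (mems_lambda p w) a = 0"
  shows "deriv (deriv (mems_lambda p w)) a \<noteq> 0"
    and "\<exists>\<delta>>0. \<forall>t s. a < t \<and> t < a + \<delta> \<and> a - \<delta> < s \<and> s < a \<longrightarrow> neg_count t = neg_count s + 1"
proof -
  let ?c = "\<lambda>t. 2 * t / w t powr (p + 2)"
  have wa: "w a > 0" using w_pos a by simp
  have "?c a * phi a = 0" using DERIV_imp_deriv[OF DERIV_lambda[OF a]] l by simp
  then have phi: "phi a = 0" using a wa by simp
  have cc: "sol_slope 0 a \<noteq> 0 \<and> (\<exists>\<delta>>0. \<forall>t s. a < t \<and> t < a + \<delta> \<and> a - \<delta> < s \<and> s < a \<longrightarrow>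
    card {\<nu>. \<nu> < 0 \<and> sol \<nu> t = 0} = card {\<nu>. \<nu> < 0 \<and> sol \<nu> s = 0} + 1)"
    by (rule crossing_count[where f = sol and J = sol_overlap and d = sol_slope and C = p])
      (use sol_cont sol_overlap_cont sol_overlap_pos sol_pos_below a DERIV_sol[OF a] sol_lagrange phi phi_eq_sol[OF a] in \<open>auto simp: sol_overlap_def\<close>)
  then show "\<exists>\<delta>>0. \<forall>t s. a < t \<and> t < a + \<delta> \<and> a - \<delta> < s \<and> s < a \<longrightarrow> neg_count t = neg_count s + 1"
    by (simp add: neg_count_def)
  have dphi: "(phi has_real_derivative - a * sol_slope 0 a) (at a)"
  proof -
    have "\<forall>\<^sub>F x in nhds a. phi x = sol 0 x" by (intro eventually_nhds_pos a phi_eq_sol)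
    then show ?thesis using DERIV_sol[OF a, of 0] by (subst DERIV_cong_ev[OF refl _ refl]) auto
  qed
  have dc: "(\<lambda>t. w t powr (p + 2)) differentiable (at a)"
    using DERIV_fun_powr[OF DERIV_w[OF a] wa, of "p + 2"] by (auto simp: real_differentiable_def)
  obtain c' where c': "(?c has_real_derivative c') (at a)"
  proof -
    have "?c differentiable (at a)" using wa by (intro derivative_intros dc) auto
    then show ?thesis using that by (auto simp: real_differentiable_def)
  qed
  have "\<forall>\<^sub>F x in nhds a. deriv (mems_lambda p w) x = ?c x * phi x"
    by (intro eventually_nhds_pos a DERIV_imp_deriv DERIV_lambda)
  moreover have "((\<lambda>x. ?c x * phi x) has_real_derivative c' * phi a + (- a * sol_slope 0 a) * ?c a) (at a)"
    by (rule DERIV_mult[OF c' dphi])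
  ultimately have "(deriv (mems_lambda p w) has_real_derivative c' * phi a + (- a * sol_slope 0 a) * ?c a) (at a)"
    by (subst DERIV_cong_ev[OF refl _ refl]) auto
  from DERIV_imp_deriv[OF this] show "deriv (deriv (mems_lambda p w)) a \<noteq> 0"
    using phi cc a wa by simp
qed

end

section \<open>Reflections and the maximum principle\<close>

text \<open>Pure second derivatives along lines are what the maximum principle consumes. As a
  relation they pass easily through sums and reflections, and they apply to the comparison function
  directly at the points where it is tested.\<close>

definition has_dir2 :: "('a::real_normed_vector \<Rightarrow> real) \<Rightarrow> 'a \<Rightarrow> 'a \<Rightarrow> real \<Rightarrow> bool" where
  "has_dir2 f x v D \<longleftrightarrow> (\<exists>g. (\<forall>\<^sub>F r in nhds 0. ((\<lambda>r. f (x + r *\<^sub>R v)) has_real_derivative g r) (at r)) \<and>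
     (g has_real_derivative D) (at 0))"

lemma has_dir2_add:
  assumes "has_dir2 f x v D" "has_dir2 g x v E"
  shows "has_dir2 (\<lambda>x. f x + g x) x v (D + E)"
proof -
  obtain f' g' where fg: "\<forall>\<^sub>F r in nhds 0. ((\<lambda>r. f (x + r *\<^sub>R v)) has_real_derivative f' r) (at r)" "(f' has_real_derivative D) (at 0)"
    "\<forall>\<^sub>F r in nhds 0. ((\<lambda>r. g (x + r *\<^sub>R v)) has_real_derivative g' r) (at r)" "(g' has_real_derivative E) (at 0)"
    using assms by (auto simp: has_dir2_def)
  then show ?thesis unfolding has_dir2_def
  proof (intro exI[of _ "\<lambda>r. f' r + g' r"] conjI DERIV_add fg(2,4))
    show "\<forall>\<^sub>F r in nhds 0. ((\<lambda>r. f (x + r *\<^sub>R v) + g (x + r *\<^sub>R v)) has_real_derivative f' r + g' r) (at r)"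
      using fg(1,3) by eventually_elim (rule DERIV_add)
  qed
qed

lemma has_dir2_cmult:
  assumes "has_dir2 f x v D"
  shows "has_dir2 (\<lambda>x. c * f x) x v (c * D)"
proof -
  obtain f' where "\<forall>\<^sub>F r in nhds 0. ((\<lambda>r. f (x + r *\<^sub>R v)) has_real_derivative f' r) (at r)" "(f' has_real_derivative D) (at 0)"
    using assms by (auto simp: has_dir2_def)
  then show ?thesis unfolding has_dir2_def
    by (intro exI[of _ "\<lambda>r. c * f' r"] conjI DERIV_cmult) (auto elim!: eventually_mono intro: DERIV_cmult)
qed

lemma has_dir2_diff:
  assumes "has_dir2 f x v D" "has_dir2 g x v E"
  shows "has_dir2 (\<lambda>x. f x - g x) x v (D - E)"
  using has_dir2_add[OF assms(1) has_dir2_cmult[OF assms(2), of "-1"]] by simp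

lemma has_dir2_unique:
  assumes "has_dir2 f x v D" "has_dir2 f x v E"
  shows "D = E"
proof -
  obtain f' g' where f': "\<forall>\<^sub>F r in nhds 0. ((\<lambda>r. f (x + r *\<^sub>R v)) has_real_derivative f' r) (at r)" "(f' has_real_derivative D) (at 0)"
    and g': "\<forall>\<^sub>F r in nhds 0. ((\<lambda>r. f (x + r *\<^sub>R v)) has_real_derivative g' r) (at r)" "(g' has_real_derivative E) (at 0)"
    using assms by (auto simp: has_dir2_def)
  have "\<forall>\<^sub>F r in nhds 0. f' r = g' r" using f'(1) g'(1) by eventually_elim (rule DERIV_unique)
  then have "(g' has_real_derivative D) (at 0)"
    using f'(2) DERIV_cong_ev[of 0 0 f' g' D D] by simp
  then show ?thesis using g'(2) by (rule DERIV_unique)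
qed

text \<open>The derivative along the line vanishes at the maximum. If \<open>D\<close> were
  positive, it would be positive just to the right, and the mean value theorem would produce a
  larger value.\<close>

lemma has_dir2_local_max:
  assumes "has_dir2 f x v D" and mx: "\<forall>\<^sub>F r in nhds 0. f (x + r *\<^sub>R v) \<le> f x"
  shows "D \<le> 0"
proof (rule ccontr)
  assume "\<not> D \<le> 0"
  obtain g where g: "\<forall>\<^sub>F r in nhds 0. ((\<lambda>r. f (x + r *\<^sub>R v)) has_real_derivative g r) (at r)" "(g has_real_derivative D) (at 0)"
    using assms by (auto simp: has_dir2_def)
  from eventually_conj[OF g(1) mx] obtain d where d: "d > 0"
    "\<And>r. \<bar>r\<bar> < d \<Longrightarrow> ((\<lambda>r. f (x + r *\<^sub>R v)) has_real_derivative g r) (at r) \<and> f (x + r *\<^sub>R v) \<le> f x"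
    unfolding eventually_nhds_metric dist_real_def by auto
  have "g 0 = 0"
    by (rule DERIV_local_max[of "\<lambda>r. f (x + r *\<^sub>R v)" _ 0 d]) (use d in auto)
  with DERIV_pos_inc_right[OF g(2)] \<open>\<not> D \<le> 0\<close> obtain e where e: "e > 0" "\<And>h. 0 < h \<Longrightarrow> h < e \<Longrightarrow> 0 < g h"
    by auto
  define h where "h = min d e / 2"
  have h: "0 < h" "h < d" "h < e" using d e by (auto simp: h_def min_def)
  have "\<exists>z. 0 < z \<and> z < h \<and> f (x + h *\<^sub>R v) - f (x + 0 *\<^sub>R v) = (h - 0) * g z"
    by (rule MVT2) (use h d in auto)
  then obtain z where z: "0 < z" "z < h" "f (x + h *\<^sub>R v) - f x = h * g z" by auto
  have "0 < h * g z" using z h e by auto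
  moreover have "f (x + h *\<^sub>R v) \<le> f x" using d(2)[of h] h by simp
  ultimately show False using z by simp
qed

lemma vec_axis_sum: "(\<Sum>i\<in>UNIV. (v $ i) *\<^sub>R axis i 1) = (v :: real ^ 'n)"
  using basis_expansion[of v] by (simp add: scalar_mult_eq_scaleR)

lemma has_derivative_line:
  assumes "(f has_derivative f') (at (x + r0 *\<^sub>R v))"
  shows "((\<lambda>r. f (x + r *\<^sub>R v)) has_real_derivative f' v) (at r0)"
proof -
  have "((\<lambda>r. x + r *\<^sub>R v) has_derivative (\<lambda>h. h *\<^sub>R v)) (at r0)"
    by (auto intro!: derivative_eq_intros)
  from has_derivative_compose[OF this assms]
  have "((\<lambda>r. f (x + r *\<^sub>R v)) has_derivative (\<lambda>h. f' (h *\<^sub>R v))) (at r0)" .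
  moreover have "f' (h *\<^sub>R v) = f' v * h" for h
    using assms by (simp add: has_derivative_def bounded_linear.linear linear_cmul mult.commute)
  ultimately show ?thesis by (simp add: has_field_derivative_def)
qed

lemma partial_eq:
  assumes "(f has_derivative f') (at x)"
  shows "partial i f x = f' (axis i 1)"
  unfolding partial_def by (rule DERIV_imp_deriv, rule has_derivative_line) (use assms in simp)

lemma has_derivative_partials:
  fixes f :: "real ^ 'n \<Rightarrow> real"
  assumes "(f has_derivative f') (at x)"
  shows "f' v = (\<Sum>i\<in>UNIV. v $ i * partial i f x)"
proof -
  have lin: "linear f'" using assms by (simp add: has_derivative_def bounded_linear.linear)
  have "f' v = f' (\<Sum>i\<in>UNIV. (v $ i) *\<^sub>R axis i 1)" by (simp add: vec_axis_sum)
  also have "\<dots> = (\<Sum>i\<in>UNIV. v $ i * f' (axis i 1))"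
    by (simp add: linear_sum[OF lin] linear_cmul[OF lin])
  finally show ?thesis by (simp add: partial_eq[OF assms])
qed

lemma differentiable_line:
  fixes f :: "real ^ 'n \<Rightarrow> real"
  assumes "f differentiable_on S" "open S" "x + r0 *\<^sub>R v \<in> S"
  shows "((\<lambda>r. f (x + r *\<^sub>R v)) has_real_derivative (\<Sum>i\<in>UNIV. v $ i * partial i f (x + r0 *\<^sub>R v))) (at r0)"
proof -
  have "f differentiable (at (x + r0 *\<^sub>R v))" using assms by (simp add: differentiable_on_eq_differentiable_at)
  then obtain f' where f': "(f has_derivative f') (at (x + r0 *\<^sub>R v))" by (auto simp: differentiable_def)
  show ?thesis using has_derivative_line[OF f'] by (simp add: has_derivative_partials[OF f'])
qed

lemma eventually_line:
  assumes "open S" "x \<in> S"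
  shows "\<forall>\<^sub>F r in nhds 0. x + r *\<^sub>R v \<in> (S :: 'a::real_normed_vector set)"
proof -
  have "open ((\<lambda>r. x + r *\<^sub>R v) -` S)" by (intro open_vimage assms continuous_intros)
  from eventually_nhds_in_open[OF this, of 0] show ?thesis using assms by simp
qed

text \<open>A general direction is allowed because a reflection takes coordinate axes to arbitrary
  unit vectors.\<close>

lemma C2_on_has_dir2:
  fixes f :: "real ^ 'n \<Rightarrow> real"
  assumes "C2_on S f" "open S" "x \<in> S"
  shows "has_dir2 f x v (\<Sum>i\<in>UNIV. \<Sum>j\<in>UNIV. v $ i * v $ j * partial j (partial i f) x)"
  unfolding has_dir2_def
proof (intro exI conjI)
  have f: "f differentiable_on S" "\<And>i. partial i f differentiable_on S" using assms(1) by (auto simp: C2_on_def)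
  show "\<forall>\<^sub>F r in nhds 0. ((\<lambda>r. f (x + r *\<^sub>R v)) has_real_derivative (\<Sum>i\<in>UNIV. v $ i * partial i f (x + r *\<^sub>R v))) (at r)"
    using eventually_line[OF assms(2,3), of v] by eventually_elim (rule differentiable_line[OF f(1) assms(2)])
  have "((\<lambda>r. \<Sum>i\<in>UNIV. v $ i * partial i f (x + r *\<^sub>R v)) has_real_derivative
     (\<Sum>i\<in>UNIV. v $ i * (\<Sum>j\<in>UNIV. v $ j * partial j (partial i f) (x + 0 *\<^sub>R v)))) (at 0)"
    by (intro DERIV_sum DERIV_cmult differentiable_line[OF f(2) assms(2)]) (use assms(3) in simp)
  then show "((\<lambda>r. \<Sum>i\<in>UNIV. v $ i * partial i f (x + r *\<^sub>R v)) has_real_derivative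
     (\<Sum>i\<in>UNIV. \<Sum>j\<in>UNIV. v $ i * v $ j * partial j (partial i f) x)) (at 0)"
    by (simp add: sum_distrib_left mult.assoc)
qed

lemma C2_on_has_dir2_axis:
  fixes f :: "real ^ 'n \<Rightarrow> real"
  assumes "C2_on S f" "open S" "x \<in> S"
  shows "has_dir2 f x (axis k 1) (partial k (partial k f) x)"
proof -
  have "(\<Sum>i\<in>UNIV. \<Sum>j\<in>UNIV. axis k 1 $ i * axis k 1 $ j * partial j (partial i f) x)
    = (\<Sum>i\<in>UNIV. if i = k then (\<Sum>j\<in>UNIV. if j = k then partial j (partial i f) x else 0) else 0)"
    unfolding axis_def
    by (rule sum.cong[OF refl], split if_split, intro conjI impI)
      (simp_all add: if_distrib[of "\<lambda>c. c * _"] cong: if_cong)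
  then show ?thesis using C2_on_has_dir2[OF assms, of "axis k 1"] by simp
qed

section \<open>Reflections in hyperplanes and comparison on a half ball\<close>

definition hyper_refl :: "'a::real_inner \<Rightarrow> 'a \<Rightarrow> 'a" where
  "hyper_refl e x = x - (2 * (x \<bullet> e)) *\<^sub>R e"

lemma hyper_refl_line: "hyper_refl e (x + r *\<^sub>R v) = hyper_refl e x + r *\<^sub>R hyper_refl e v"
  by (simp add: hyper_refl_def algebra_simps inner_add_left)

lemma norm_hyper_refl: assumes "e \<bullet> e = 1" shows "norm (hyper_refl e x) = norm x"
proof -
  have "hyper_refl e x \<bullet> hyper_refl e x = x \<bullet> x"
    using assms by (simp add: hyper_refl_def inner_diff_left inner_diff_right inner_commute power2_eq_square algebra_simps)
  then show ?thesis by (simp add: norm_eq)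
qed

lemma hyper_refl_orthonormal:
  fixes e :: "real ^ 'n"
  assumes "e \<bullet> e = 1"
  shows "(\<Sum>k\<in>UNIV. hyper_refl e (axis k 1) $ i * hyper_refl e (axis k 1) $ j) = (if i = j then 1 else 0)"
proof -
  have ee: "(\<Sum>k\<in>UNIV. e $ k * e $ k) = 1" using assms by (simp add: inner_vec_def)
  have comp: "hyper_refl e (axis k 1) $ i = (if k = i then 1 else 0) - 2 * e $ k * e $ i" for k i
    by (auto simp: hyper_refl_def inner_axis') (auto simp: axis_def)
  have "(\<Sum>k\<in>UNIV. hyper_refl e (axis k 1) $ i * hyper_refl e (axis k 1) $ j)
    = (\<Sum>k\<in>UNIV. (if k = i then (if i = j then 1 else 0) else 0) - (if k = i then 2 * e $ i * e $ j else 0)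
        - (if k = j then 2 * e $ i * e $ j else 0) + 4 * e $ i * e $ j * (e $ k * e $ k))"
    by (intro sum.cong) (auto simp: comp algebra_simps)
  also have "\<dots> = (if i = j then 1 else 0)"
    unfolding sum.distrib sum_subtractf sum_distrib_left[symmetric] ee by simp
  finally show ?thesis .
qed

text \<open>Along an axis the reflected function is \<open>f\<close> along the reflected axis. The
  reflected axes are orthonormal, so the quadratic forms of the second derivatives add up to the
  trace.\<close>

lemma C2_on_reflected_laplacian:
  fixes f :: "real ^ 'n \<Rightarrow> real"
  assumes "C2_on S f" "open S" "hyper_refl e x \<in> S" "e \<bullet> e = 1"
  shows "\<exists>D. (\<forall>k. has_dir2 (\<lambda>x. f (hyper_refl e x)) x (axis k 1) (D k)) \<and> (\<Sum>k\<in>UNIV. D k) = laplacian f (hyper_refl e x)"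
proof (intro exI conjI allI)
  let ?s = "hyper_refl e"
  let ?D = "\<lambda>k. \<Sum>i\<in>UNIV. \<Sum>j\<in>UNIV. ?s (axis k 1) $ i * ?s (axis k 1) $ j * partial j (partial i f) (?s x)"
  show "has_dir2 (\<lambda>x. f (?s x)) x (axis k 1) (?D k)" for k
    using C2_on_has_dir2[OF assms(1-3), of "?s (axis k 1)"] by (simp add: has_dir2_def hyper_refl_line)
  have "(\<Sum>k\<in>UNIV. ?D k) = (\<Sum>i\<in>UNIV. \<Sum>j\<in>UNIV. (\<Sum>k\<in>UNIV. ?s (axis k 1) $ i * ?s (axis k 1) $ j) * partial j (partial i f) (?s x))"
    unfolding sum_distrib_right by (rule trans[OF sum.swap], rule sum.cong[OF refl], rule sum.swap)
  also have "\<dots> = laplacian f (?s x)"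
    by (simp add: hyper_refl_orthonormal[OF assms(4)] laplacian_def if_distrib[of "\<lambda>c. c * _"] cong: if_cong)
  finally show "(\<Sum>k\<in>UNIV. ?D k) = laplacian f (?s x)" .
qed

text \<open>The quotient of the odd part of \<open>\<omega>\<close> by the strict supersolution \<open>k\<close> has no positive
  interior maximum, and it vanishes on the boundary of the half ball.\<close>
lemma half_ball_comparison:
  fixes \<omega> k V :: "real ^ 'n \<Rightarrow> real"
  assumes \<omega>: "dirichlet_eigenfunction V \<mu> \<omega>" and V: "\<And>x. V (hyper_refl e x) = V x" and e: "e \<bullet> e = 1"
    and kc: "continuous_on {x \<in> cball 0 1. 0 \<le> x \<bullet> e} k"
    and kp: "\<And>x. x \<in> cball 0 1 \<Longrightarrow> 0 \<le> x \<bullet> e \<Longrightarrow> k x > 0"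
    and kD: "\<And>x. x \<in> ball 0 1 \<Longrightarrow> 0 < x \<bullet> e \<Longrightarrow> \<exists>D. (\<forall>i. has_dir2 k x (axis i 1) (D i)) \<and> (\<Sum>i\<in>UNIV. D i) + (V x + \<mu>) * k x < 0"
    and x: "x \<in> ball 0 1" "0 < x \<bullet> e"
  shows "\<omega> x \<le> \<omega> (hyper_refl e x)"
proof -
  let ?s = "hyper_refl e" and ?H = "{x \<in> cball 0 1. 0 \<le> x \<bullet> e}"
  let ?\<psi> = "\<lambda>x. \<omega> x - \<omega> (?s x)"
  have C2: "C2_on (ball 0 1) \<omega>" and cont: "continuous_on (cball 0 1) \<omega>" and bd: "\<And>x. 1 \<le> norm x \<Longrightarrow> \<omega> x = 0"
    and pde: "\<And>x. x \<in> ball 0 1 \<Longrightarrow> laplacian \<omega> x + V x * \<omega> x + \<mu> * \<omega> x = 0"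
    using \<omega> by (auto simp: dirichlet_eigenfunction_def)
  have "?H = cball 0 1 \<inter> {x. 0 \<le> x \<bullet> e}" by auto
  moreover have "closed {x. 0 \<le> x \<bullet> e}" by (intro closed_Collect_le continuous_intros)
  ultimately have "compact ?H" by (simp add: compact_Int_closed)
  moreover have "x \<in> ?H" using x by auto
  moreover have "continuous_on ?H (\<lambda>x. ?\<psi> x / k x)"
  proof (intro continuous_on_divide continuous_on_diff kc)
    show "continuous_on ?H \<omega>" by (rule continuous_on_subset[OF cont]) auto
    show "continuous_on ?H (\<lambda>x. \<omega> (?s x))"
      by (rule continuous_on_compose2[OF cont]) (auto simp: hyper_refl_def[abs_def] norm_hyper_refl[OF e, unfolded hyper_refl_def] intro!: continuous_intros)
  qed (use kp in force)
  ultimately obtain z where z: "z \<in> ?H" and zmax: "\<And>y. y \<in> ?H \<Longrightarrow> ?\<psi> y / k y \<le> ?\<psi> z / k z"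
    using continuous_attains_sup[of ?H] by blast
  define M where "M = ?\<psi> z / k z"
  have kz: "k z > 0" using kp z by auto
  have "M \<le> 0"
  proof (rule ccontr)
    assume M: "\<not> M \<le> 0"
    then have \<psi>z: "?\<psi> z \<noteq> 0" by (auto simp: M_def)
    \<comment> \<open>On the sphere both terms of the odd part vanish, on the hyperplane they
      coincide; a positive maximum is therefore attained inside the open half ball.\<close>
    have "norm z \<noteq> 1" using \<psi>z bd[of z] bd[of "?s z"] by (auto simp: norm_hyper_refl[OF e])
    then have zb: "z \<in> ball 0 1" using z by auto
    have "z \<bullet> e \<noteq> 0" using \<psi>z by (auto simp: hyper_refl_def)
    then have ze: "0 < z \<bullet> e" using z by auto
    obtain D where D: "\<And>i. has_dir2 k z (axis i 1) (D i)" "(\<Sum>i\<in>UNIV. D i) + (V z + \<mu>) * k z < 0"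
      using kD[OF zb ze] by auto
    have sz: "?s z \<in> ball 0 1" using zb by (simp add: norm_hyper_refl[OF e])
    obtain A where A: "\<And>i. has_dir2 (\<lambda>x. \<omega> (?s x)) z (axis i 1) (A i)" "(\<Sum>i\<in>UNIV. A i) = laplacian \<omega> (?s z)"
      using C2_on_reflected_laplacian[OF C2 open_ball sz e] by auto
    \<comment> \<open>Instead of differentiating the quotient, its maximum is restated as
      \<open>?F \<le> 0\<close> near \<open>z\<close> with equality at \<open>z\<close>; this is
      linear in the second derivatives.\<close>
    let ?F = "\<lambda>x. ?\<psi> x - M * k x"
    have Fz: "?F z = 0" using kz by (simp add: M_def)
    have opn: "open (ball 0 1 \<inter> {x. 0 < x \<bullet> e})" by (intro open_Int open_ball open_Collect_less continuous_intros)
    have zin: "z \<in> ball 0 1 \<inter> {x. 0 < x \<bullet> e}" using zb ze by simp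
    have le: "partial i (partial i \<omega>) z - A i - M * D i \<le> 0" for i
    proof (rule has_dir2_local_max[of ?F z "axis i 1"])
      show "has_dir2 ?F z (axis i 1) (partial i (partial i \<omega>) z - A i - M * D i)"
        by (intro has_dir2_diff has_dir2_cmult C2_on_has_dir2_axis[OF C2 open_ball zb] A D)
      show "\<forall>\<^sub>F r in nhds 0. ?F (z + r *\<^sub>R axis i 1) \<le> ?F z"
        using eventually_line[OF opn zin, of "axis i 1"]
      proof eventually_elim
        fix r assume "z + r *\<^sub>R axis i 1 \<in> ball 0 1 \<inter> {x. 0 < x \<bullet> e}" (is "?y \<in> _")
        then have y: "norm ?y < 1" "0 < ?y \<bullet> e" by auto
        then have "?y \<in> ?H" by auto
        from zmax[OF this] kp[of ?y] y have "?\<psi> ?y \<le> M * k ?y" unfolding M_def[symmetric]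
          by (auto simp: pos_divide_le_eq)
        then show "?F ?y \<le> ?F z" using Fz by simp
      qed
    qed
    have "(\<Sum>i\<in>UNIV. partial i (partial i \<omega>) z - A i - M * D i) \<le> 0" by (intro sum_nonpos le)
    then have "laplacian \<omega> z - laplacian \<omega> (?s z) - M * (\<Sum>i\<in>UNIV. D i) \<le> 0"
      by (simp add: sum_subtractf sum_distrib_left A(2) laplacian_def)
    moreover have "laplacian \<omega> z - laplacian \<omega> (?s z) = - (V z + \<mu>) * ?\<psi> z"
      using pde[OF zb] pde[OF sz] V[of z] by (simp add: algebra_simps)
    moreover have "?\<psi> z = M * k z" using Fz by simp
    ultimately have "0 \<le> M * ((\<Sum>i\<in>UNIV. D i) + (V z + \<mu>) * k z)" by (simp add: algebra_simps)
    then show False using M D(2) by (simp add: zero_le_mult_iff)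
  qed
  moreover have "?\<psi> x / k x \<le> M" unfolding M_def using zmax x by auto
  ultimately have "?\<psi> x / k x \<le> 0" by linarith
  then show ?thesis using kp[of x] x by (simp add: divide_le_0_iff)
qed

section \<open>Radial functions\<close>

lemma DERIV_norm_line:
  fixes x v :: "'a::real_inner"
  assumes "x + r0 *\<^sub>R v \<noteq> 0"
  shows "((\<lambda>r. norm (x + r *\<^sub>R v)) has_real_derivative (x + r0 *\<^sub>R v) \<bullet> v / norm (x + r0 *\<^sub>R v)) (at r0)"
proof -
  have line: "((\<lambda>r. x + r *\<^sub>R v) has_derivative (\<lambda>h. h *\<^sub>R v)) (at r0)"
    by (auto intro!: derivative_eq_intros)
  have d: "((\<lambda>r. norm (x + r *\<^sub>R v)) has_derivative (\<lambda>h. (h *\<^sub>R v) \<bullet> sgn (x + r0 *\<^sub>R v))) (at r0)"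
    by (rule has_derivative_compose[OF line has_derivative_norm[OF assms]])
  have eq: "(\<lambda>h. (h *\<^sub>R v) \<bullet> sgn (x + r0 *\<^sub>R v)) = (*) ((x + r0 *\<^sub>R v) \<bullet> v / norm (x + r0 *\<^sub>R v))"
    by (rule ext) (simp add: sgn_div_norm inner_commute divide_inverse mult_ac)
  show ?thesis using d unfolding eq has_field_derivative_def .
qed

lemma DERIV_inner_line: "((\<lambda>r. (x + r *\<^sub>R v) \<bullet> e) has_real_derivative v \<bullet> e) (at r0)"
  for x v e :: "'a::real_inner"
  unfolding inner_add_left inner_scaleR_left by (auto intro!: derivative_eq_intros)

text \<open>Writing the derivative of \<open>c\<close> as \<open>r * B r\<close> cancels the
  quotient in the gradient of \<open>c (norm x)\<close>: along \<open>v\<close> it is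
  \<open>B (norm x) * (x \<bullet> v)\<close>, and only \<open>B\<close> has to be differentiated
  once more.\<close>

lemma has_dir2_radial_linear:
  fixes x v e :: "'a::real_inner"
  assumes x: "x \<noteq> 0"
    and c: "\<And>r. r > 0 \<Longrightarrow> (c has_real_derivative r * B r) (at r)"
    and B: "(B has_real_derivative B1) (at (norm x))"
  shows "has_dir2 (\<lambda>x. c (norm x) * (x \<bullet> e)) x v
    (B1 * (x \<bullet> v)\<^sup>2 * (x \<bullet> e) / norm x + B (norm x) * (x \<bullet> e) * (v \<bullet> v) + 2 * B (norm x) * (x \<bullet> v) * (v \<bullet> e))"
proof -
  let ?y = "\<lambda>r. x + r *\<^sub>R v"
  let ?g = "\<lambda>r. B (norm (?y r)) * (?y r \<bullet> v) * (?y r \<bullet> e) + c (norm (?y r)) * (v \<bullet> e)"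
  have dc: "((\<lambda>r. c (norm (?y r))) has_real_derivative B (norm (?y r0)) * (?y r0 \<bullet> v)) (at r0)" if "?y r0 \<noteq> 0" for r0
    using DERIV_chain2[OF c DERIV_norm_line[OF that]] that by simp
  show ?thesis unfolding has_dir2_def
  proof (intro exI[of _ ?g] conjI)
    have "\<forall>\<^sub>F r in nhds 0. ?y r \<in> - {0}" by (rule eventually_line) (use x in \<open>auto intro: open_Compl\<close>)
    then show "\<forall>\<^sub>F r in nhds 0. ((\<lambda>r. c (norm (?y r)) * (?y r \<bullet> e)) has_real_derivative ?g r) (at r)"
    proof eventually_elim
      case (elim r)
      then have "?y r \<noteq> 0" by simp
      from DERIV_mult[OF dc[OF this] DERIV_inner_line[of x v e r]] show ?case
        by (simp add: mult_ac add_ac)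
    qed
    have y0: "?y 0 \<noteq> 0" using x by simp
    have dB: "((\<lambda>r. B (norm (?y r))) has_real_derivative B1 * (?y 0 \<bullet> v / norm (?y 0))) (at 0)"
      by (rule DERIV_chain2[OF _ DERIV_norm_line[OF y0]]) (use B in simp)
    have "(?g has_real_derivative (B1 * (?y 0 \<bullet> v / norm (?y 0)) * (?y 0 \<bullet> v) + (v \<bullet> v) * B (norm (?y 0))) * (?y 0 \<bullet> e)
       + (v \<bullet> e) * (B (norm (?y 0)) * (?y 0 \<bullet> v)) + B (norm (?y 0)) * (?y 0 \<bullet> v) * (v \<bullet> e)) (at 0)"
      by (intro DERIV_add DERIV_mult DERIV_inner_line dB DERIV_cmult_right dc y0)
    then show "(?g has_real_derivative B1 * (x \<bullet> v)\<^sup>2 * (x \<bullet> e) / norm x + B (norm x) * (x \<bullet> e) * (v \<bullet> v) + 2 * B (norm x) * (x \<bullet> v) * (v \<bullet> e)) (at 0)"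
      by (rule DERIV_cong) (simp add: algebra_simps power2_eq_square)
  qed
qed

lemma has_dir2_gaussian:
  fixes x v e :: "'a::real_inner"
  shows "has_dir2 (\<lambda>x. exp (- K * (x \<bullet> e)\<^sup>2)) x v ((4 * K\<^sup>2 * (x \<bullet> e)\<^sup>2 - 2 * K) * (v \<bullet> e)\<^sup>2 * exp (- K * (x \<bullet> e)\<^sup>2))"
proof -
  let ?y = "\<lambda>r. x + r *\<^sub>R v"
  let ?g = "\<lambda>r. exp (- K * (?y r \<bullet> e)\<^sup>2) * (- K * (2 * (?y r \<bullet> e) * (v \<bullet> e)))"
  have d: "((\<lambda>r. exp (- K * (?y r \<bullet> e)\<^sup>2)) has_real_derivative ?g r) (at r)" for r
    by (rule derivative_eq_intros DERIV_inner_line refl)+ simp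
  show ?thesis unfolding has_dir2_def
  proof (intro exI[of _ ?g] conjI always_eventually allI d)
    have "(?g has_real_derivative ?g 0 * (- K * (2 * (?y 0 \<bullet> e) * (v \<bullet> e))) + (- K * (2 * (v \<bullet> e) * (v \<bullet> e))) * exp (- K * (?y 0 \<bullet> e)\<^sup>2)) (at 0)"
      by (intro DERIV_mult d DERIV_cmult DERIV_cmult_right DERIV_inner_line)
    then show "(?g has_real_derivative (4 * K\<^sup>2 * (x \<bullet> e)\<^sup>2 - 2 * K) * (v \<bullet> e)\<^sup>2 * exp (- K * (x \<bullet> e)\<^sup>2)) (at 0)"
      by (rule DERIV_cong) (simp add: algebra_simps power2_eq_square)
  qed
qed

lemma partial_cong:
  assumes "open S" "x \<in> S" "\<And>y. y \<in> S \<Longrightarrow> f y = g y"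
  shows "partial i f x = partial i g x"
  unfolding partial_def
proof (rule deriv_cong_ev[OF _ refl])
  show "\<forall>\<^sub>F r in nhds 0. f (x + r *\<^sub>R axis i 1) = g (x + r *\<^sub>R axis i 1)"
    using eventually_line[OF assms(1,2), of "axis i 1"] by eventually_elim (rule assms(3))
qed

text \<open>Eigenfunctions are cut off to 0 outside the ball; on the open ball they inherit
  regularity and Laplacian from the untruncated function.\<close>

lemma C2_on_cong:
  fixes f g :: "real ^ 'n \<Rightarrow> real"
  assumes S: "open S" and fg: "\<And>y. y \<in> S \<Longrightarrow> f y = g y" and C2: "C2_on T f" "S \<subseteq> T"
  shows "C2_on S g" and "\<And>x. x \<in> S \<Longrightarrow> laplacian g x = laplacian f x"
proof -
  have p1: "partial i f x = partial i g x" if "x \<in> S" for i x by (rule partial_cong[OF S that fg])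
  have p2: "partial j (partial i f) x = partial j (partial i g) x" if "x \<in> S" for i j x
    by (rule partial_cong[OF S that p1])
  show "laplacian g x = laplacian f x" if "x \<in> S" for x using p2[OF that] by (simp add: laplacian_def)
  have f: "f differentiable_on S" "\<And>i. partial i f differentiable_on S" "\<And>i j. continuous_on S (partial j (partial i f))"
    using C2 by (auto simp: C2_on_def intro: differentiable_on_subset continuous_on_subset[of T])
  have tr: "u' differentiable_on S" if "u differentiable_on S" "\<And>x. x \<in> S \<Longrightarrow> u x = u' x" for u u' :: "real ^ 'n \<Rightarrow> real"
    using that unfolding differentiable_on_def differentiable_def
    by (metis has_derivative_transform)
  have "g differentiable_on S" by (rule tr[OF f(1) fg])
  moreover have "partial i g differentiable_on S" for i by (rule tr[OF f(2) p1])
  moreover have "continuous_on S (partial j (partial i g))" for i j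
    using f(3)[of j i] by (rule continuous_on_eq) (rule p2)
  ultimately show "C2_on S g" by (simp add: C2_on_def)
qed

lemma has_derivative_norm_comp:
  fixes x :: "'a::real_inner"
  assumes "x \<noteq> 0" "(Y has_real_derivative D) (at (norm x))"
  shows "((\<lambda>x. Y (norm x)) has_derivative (\<lambda>h. D / norm x * (x \<bullet> h))) (at x)"
proof -
  have "((\<lambda>x. Y (norm x)) has_derivative (\<lambda>h. (h \<bullet> sgn x) * D)) (at x)"
    by (rule DERIV_compose_FDERIV[OF assms(2) has_derivative_norm[OF assms(1)]])
  moreover have "(h \<bullet> sgn x) * D = D / norm x * (x \<bullet> h)" for h
    by (simp add: sgn_div_norm inner_commute divide_inverse mult_ac)
  ultimately show ?thesis by simp
qed

lemma has_derivative_at_0I: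
  fixes f :: "'a::real_normed_vector \<Rightarrow> real"
  assumes "bounded_linear D" "\<And>h. \<bar>f h - f 0 - D h\<bar> \<le> \<bar>E h\<bar> * norm h" "(E \<longlongrightarrow> 0) (at 0)"
  shows "(f has_derivative D) (at 0)"
  unfolding has_derivative_at
proof (intro conjI assms(1))
  show "(\<lambda>h. norm (f (0 + h) - f 0 - D h) / norm h) \<midarrow>0\<rightarrow> 0"
  proof (rule Lim_null_comparison[OF _ tendsto_norm_zero[OF assms(3)]])
    have "norm (norm (f (0 + h) - f 0 - D h) / norm h) \<le> norm (E h)" for h
      using assms(2)[of h] by (cases "h = 0") (auto simp: pos_divide_le_eq)
    then show "\<forall>\<^sub>F h in at 0. norm (norm (f (0 + h) - f 0 - D h) / norm h) \<le> norm (E h)" by simp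
  qed
qed

lemma tendsto_norm_comp_0:
  assumes "continuous_on UNIV (H :: real \<Rightarrow> real)"
  shows "((\<lambda>h. H (norm h)) \<longlongrightarrow> H 0) (at (0::'a::real_normed_vector))"
proof -
  have "isCont H (norm (0::'a))" using assms by (simp add: continuous_on_eq_continuous_at)
  from isCont_o2[OF isCont_norm[OF continuous_ident] this] show ?thesis by (simp add: isCont_def)
qed

text \<open>\<open>S = - Y' / r\<close> stays continuous at the origin; \<open>H\<close> is the quadratic remainder of \<open>Y\<close> there.\<close>
lemma radial_C2:
  fixes Y S G H :: "real \<Rightarrow> real"
  assumes Y: "\<And>r. r > 0 \<Longrightarrow> (Y has_real_derivative - r * S r) (at r)"
    and S: "\<And>r. r > 0 \<Longrightarrow> (S has_real_derivative (G r - real CARD('n) * S r) / r) (at r)"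
    and Sc: "continuous_on UNIV S" and Gc: "continuous_on UNIV G" and Hc: "continuous_on UNIV H"
    and S0: "real CARD('n) * S 0 = G 0" and Y0: "\<And>r. Y r = Y 0 - r\<^sup>2 * H r"
  shows "C2_on UNIV (\<lambda>x :: real ^ 'n::finite. Y (norm x))"
    and "laplacian (\<lambda>x :: real ^ 'n. Y (norm x)) x = - G (norm x)"
proof -
  let ?n = "real CARD('n)"
  let ?f = "\<lambda>x :: real ^ 'n. Y (norm x)"
  let ?K = "\<lambda>r. G r - ?n * S r"
  have d1: "(?f has_derivative (\<lambda>h. - S (norm x) * (x \<bullet> h))) (at x)" for x
  proof (cases "x = 0")
    case False
    from has_derivative_norm_comp[OF this Y] False show ?thesis by simp
  next
    case True
    have "(?f has_derivative (\<lambda>h. 0)) (at 0)"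
    proof (rule has_derivative_at_0I[where E = "\<lambda>h. norm h * H (norm h)"])
      fix h :: "real ^ 'n"
      have "Y (norm h) - Y 0 = - ((norm h)\<^sup>2 * H (norm h))" using Y0[of "norm h"] by simp
      then show "\<bar>Y (norm h) - Y (norm (0 :: real ^ 'n)) - 0\<bar> \<le> \<bar>norm h * H (norm h)\<bar> * norm h"
        by (simp add: abs_mult power2_eq_square)
      show "((\<lambda>h::real ^ 'n. norm h * H (norm h)) \<longlongrightarrow> 0) (at 0)"
        using tendsto_mult[OF tendsto_norm_zero[OF tendsto_ident_at] tendsto_norm_comp_0[OF Hc]] by simp
    qed simp
    then show ?thesis using True by simp
  qed
  have p1: "partial i ?f = (\<lambda>x. - S (norm x) * x $ i)" for i
    using partial_eq[OF d1] by (auto simp: inner_axis)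
  have lin: "((\<lambda>x :: real ^ 'n. x $ i) has_derivative (\<lambda>h. h $ i)) (at x)" for i x
    by (rule bounded_linear_imp_has_derivative) (rule bounded_linear_vec_nth)
  have d2: "(partial i ?f has_derivative (\<lambda>h. - (?K (norm x) * (x $ i / (norm x)\<^sup>2 * (x \<bullet> h))) - S (norm x) * h $ i)) (at x)" for i x
  proof (cases "x = 0")
    case False
    then have nx: "norm x > 0" by simp
    have "((\<lambda>x. S (norm x) * x $ i) has_derivative
       (\<lambda>h. S (norm x) * h $ i + (?K (norm x) / norm x) / norm x * (x \<bullet> h) * x $ i)) (at x)"
      by (rule has_derivative_mult[OF has_derivative_norm_comp[OF False S[OF nx]] lin])
    from has_derivative_minus[OF this] show ?thesis
      unfolding p1 mult_minus_left
      by (rule has_derivative_eq_rhs) (simp add: fun_eq_iff power2_eq_square algebra_simps add_divide_distrib diff_divide_distrib)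
  next
    case True
    have "(partial i ?f has_derivative (\<lambda>h. - S 0 * h $ i)) (at 0)"
    proof (rule has_derivative_at_0I[where E = "\<lambda>h. S (norm h) - S 0"])
      show "bounded_linear (\<lambda>h :: real ^ 'n. - S 0 * h $ i)"
        by (intro bounded_linear_mult_const[THEN bounded_linear_compose] bounded_linear_mult_right[THEN bounded_linear_compose] bounded_linear_vec_nth)
      fix h :: "real ^ 'n"
      have "\<bar>S (norm h) - S 0\<bar> * \<bar>h $ i\<bar> \<le> \<bar>S (norm h) - S 0\<bar> * norm h"
        by (rule mult_left_mono[OF component_le_norm_cart]) simp
      moreover have "\<bar>partial i ?f h - partial i ?f 0 - - S 0 * h $ i\<bar> = \<bar>S (norm h) - S 0\<bar> * \<bar>h $ i\<bar>"
        unfolding p1 by (simp add: abs_mult[symmetric] algebra_simps abs_minus_commute)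
      ultimately show "\<bar>partial i ?f h - partial i ?f 0 - - S 0 * h $ i\<bar> \<le> \<bar>S (norm h) - S 0\<bar> * norm h" by simp
      show "((\<lambda>h::real ^ 'n. S (norm h) - S 0) \<longlongrightarrow> 0) (at 0)"
        using tendsto_diff[OF tendsto_norm_comp_0[OF Sc] tendsto_const[of "S 0"]] by simp
    qed
    then show ?thesis using True by simp
  qed
  \<comment> \<open>At the origin division by zero makes the quotient 0, so one formula covers all
    points: the value left there is the one found in the second case of \<open>d2\<close>.\<close>
  have p2: "partial j (partial i ?f) = (\<lambda>x. - (?K (norm x) * (x $ i / (norm x)\<^sup>2 * x $ j)) - (if i = j then S (norm x) else 0))" for i j
    by (rule ext) (unfold partial_eq[OF d2] inner_axis, auto simp: axis_def)
  have Kc: "continuous_on UNIV ?K" by (intro continuous_intros Sc Gc)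
  have comp: "continuous_on A (\<lambda>x :: real ^ 'n. F (norm x))" if "continuous_on UNIV F" for A and F :: "real \<Rightarrow> real"
    by (rule continuous_on_compose2[OF that]) (auto intro!: continuous_intros)
  have c2: "continuous_on UNIV (partial j (partial i ?f))" for i j
  proof -
    have "isCont (\<lambda>x :: real ^ 'n. ?K (norm x) * (x $ i / (norm x)\<^sup>2 * x $ j)) x" for x
    proof (cases "x = 0")
      case False
      have "continuous_on (- {0}) (\<lambda>x :: real ^ 'n. ?K (norm x) * (x $ i / (norm x)\<^sup>2 * x $ j))"
        by (intro continuous_intros comp Kc) auto
      then show ?thesis using False by (simp add: continuous_on_eq_continuous_at open_Compl)
    next
      case True
      \<comment> \<open>The angular factor need not have a limit at the origin, but it is bounded by
        1, and \<open>?K 0 = 0\<close> by \<open>S0\<close> forces the product to 0.\<close>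
      have "((\<lambda>x :: real ^ 'n. ?K (norm x) * (x $ i / (norm x)\<^sup>2 * x $ j)) \<longlongrightarrow> 0) (at 0)"
      proof (rule Lim_null_comparison[OF always_eventually])
        show "((\<lambda>x :: real ^ 'n. norm (?K (norm x))) \<longlongrightarrow> 0) (at 0)"
          using tendsto_norm_zero[of "\<lambda>x :: real ^ 'n. ?K (norm x)"] tendsto_norm_comp_0[OF Kc, where 'a = "real ^ 'n"] S0 by simp
        show "\<forall>x :: real ^ 'n. norm (?K (norm x) * (x $ i / (norm x)\<^sup>2 * x $ j)) \<le> norm (?K (norm x))"
        proof
          fix x :: "real ^ 'n"
          have "\<bar>x $ i\<bar> * \<bar>x $ j\<bar> \<le> norm x * norm x" by (intro mult_mono component_le_norm_cart) auto
          then have "\<bar>x $ i / (norm x)\<^sup>2 * x $ j\<bar> \<le> 1"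
            by (cases "x = 0") (auto simp: abs_mult power2_eq_square divide_simps)
          then have "\<bar>?K (norm x)\<bar> * \<bar>x $ i / (norm x)\<^sup>2 * x $ j\<bar> \<le> \<bar>?K (norm x)\<bar> * 1"
            by (rule mult_left_mono) simp
          then show "norm (?K (norm x) * (x $ i / (norm x)\<^sup>2 * x $ j)) \<le> norm (?K (norm x))"
            by (simp only: real_norm_def abs_mult mult_1_right)
        qed
      qed
      then show ?thesis using True by (simp add: isCont_def)
    qed
    then have "continuous_on UNIV (\<lambda>x :: real ^ 'n. ?K (norm x) * (x $ i / (norm x)\<^sup>2 * x $ j))"
      by (simp add: continuous_at_imp_continuous_on)
    moreover have "continuous_on UNIV (\<lambda>x :: real ^ 'n. if i = j then S (norm x) else 0)"
      by (cases "i = j") (auto intro!: comp Sc)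
    ultimately show ?thesis unfolding p2 by (intro continuous_on_diff continuous_on_minus)
  qed
  show "C2_on UNIV ?f"
    unfolding C2_on_def differentiable_on_def differentiable_def
    using d1 d2 c2 by (blast intro: has_derivative_at_withinI)
  show "laplacian ?f x = - G (norm x)"
  proof (cases "x = 0")
    case True
    then show ?thesis using S0 by (simp add: laplacian_def p2)
  next
    case False
    have "(\<Sum>i\<in>UNIV. x $ i / (norm x)\<^sup>2 * x $ i) = (x \<bullet> x) / (norm x)\<^sup>2"
      by (simp add: inner_vec_def sum_divide_distrib)
    also have "\<dots> = 1" using False by (simp add: power2_norm_eq_inner)
    finally have s: "(\<Sum>i\<in>UNIV. x $ i / (norm x)\<^sup>2 * x $ i) = 1" .
    have "laplacian ?f x = - (?K (norm x) * (\<Sum>i\<in>UNIV. x $ i / (norm x)\<^sup>2 * x $ i)) - ?n * S (norm x)"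
      unfolding sum_distrib_left laplacian_def p2 by (simp add: sum_subtractf sum_negf)
    then show ?thesis unfolding s by simp
  qed
qed

text \<open>On the axis \<open>k\<close> one second derivative is that of the radial part
  \<open>f\<close>. Each of the other directions contributes \<open>f1 r / r\<close>, because a
  transversal step changes the norm only to second order.\<close>

lemma radial_laplacian_ode:
  fixes \<omega> :: "real ^ 'n::finite \<Rightarrow> real" and k :: 'n
  assumes C2: "C2_on (ball 0 1) \<omega>"
    and rad: "\<And>x y. x \<in> ball 0 1 \<Longrightarrow> norm x = norm y \<Longrightarrow> \<omega> x = \<omega> y"
  defines "f \<equiv> \<lambda>r. \<omega> (r *\<^sub>R axis k 1)" and "f1 \<equiv> \<lambda>r. partial k \<omega> (r *\<^sub>R axis k 1)"
  shows "\<And>r. 0 < r \<Longrightarrow> r < 1 \<Longrightarrow> (f has_real_derivative f1 r) (at r)"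
    and "\<And>r. 0 < r \<Longrightarrow> r < 1 \<Longrightarrow>
      (f1 has_real_derivative laplacian \<omega> (r *\<^sub>R axis k 1) - (real CARD('n) - 1) / r * f1 r) (at r)"
    and "(f \<longlongrightarrow> \<omega> 0) (at_right 0)" "(f1 \<longlongrightarrow> 0) (at_right 0)"
proof -
  let ?B = "ball 0 1 :: (real ^ 'n) set"
  have dif: "\<omega> differentiable_on ?B" "partial k \<omega> differentiable_on ?B" using C2 by (auto simp: C2_on_def)
  have ax: "(\<Sum>i\<in>UNIV. axis k 1 $ i * c i) = c k" for c :: "'n \<Rightarrow> real"
  proof -
    have "(\<Sum>i\<in>UNIV. axis k 1 $ i * c i) = (\<Sum>i\<in>UNIV. if i = k then c i else 0)"
      by (intro sum.cong) (auto simp: axis_def)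
    then show ?thesis by simp
  qed
  have df: "(f has_real_derivative f1 r) (at r)" if "\<bar>r\<bar> < 1" for r
    using differentiable_line[OF dif(1) open_ball, of 0 r "axis k 1"] that by (simp add: f_def f1_def ax)
  have df1: "(f1 has_real_derivative partial k (partial k \<omega>) (r *\<^sub>R axis k 1)) (at r)" if "\<bar>r\<bar> < 1" for r
    using differentiable_line[OF dif(2) open_ball, of 0 r "axis k 1"] that by (simp add: f1_def ax)
  show "(f has_real_derivative f1 r) (at r)" if "0 < r" "r < 1" for r using df that by simp
  \<comment> \<open>Radial symmetry makes \<open>f\<close> even, hence its derivative at 0 equals
    its own negative.\<close>
  have "f1 0 = 0"
  proof -
    have "((\<lambda>r. f (- r)) has_real_derivative f1 0 * (- 1)) (at 0)"
      by (rule DERIV_chain2[of f "f1 0" "\<lambda>r. - r" 0 "- 1"]) (use df[of 0] in \<open>auto intro!: derivative_eq_intros\<close>)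
    moreover have "\<forall>\<^sub>F r in nhds 0. f (- r) = f r"
    proof -
      have "\<forall>\<^sub>F r :: real in nhds 0. r \<in> ball 0 1" by (rule eventually_nhds_in_open) auto
      then show ?thesis by eventually_elim (auto simp: f_def intro!: rad)
    qed
    ultimately have "(f has_real_derivative f1 0 * (- 1)) (at 0)"
      using DERIV_cong_ev[of 0 0 "\<lambda>r. f (- r)" f "f1 0 * (- 1)" "f1 0 * (- 1)"] by simp
    moreover have "(f has_real_derivative f1 0) (at 0)" by (rule df) simp
    ultimately have "f1 0 * (- 1) = f1 0" by (rule DERIV_unique)
    then show ?thesis by simp
  qed
  have "isCont f 0" by (rule DERIV_isCont, rule df) simp
  moreover have "isCont f1 0" by (rule DERIV_isCont, rule df1) simp
  ultimately have "(f \<longlongrightarrow> f 0) (at_right 0)" "(f1 \<longlongrightarrow> f1 0) (at_right 0)"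
    by (auto simp: isCont_def intro: tendsto_within_subset)
  then show "(f \<longlongrightarrow> \<omega> 0) (at_right 0)" "(f1 \<longlongrightarrow> 0) (at_right 0)"
    using \<open>f1 0 = 0\<close> by (simp_all add: f_def)
  fix r :: real assume r: "0 < r" "r < 1"
  let ?x = "r *\<^sub>R axis k 1 :: real ^ 'n"
  have x: "?x \<in> ?B" using r by simp
  have other: "partial i (partial i \<omega>) ?x = f1 r / r" if "i \<noteq> k" for i
  proof (rule has_dir2_unique[OF C2_on_has_dir2_axis[OF C2 open_ball x]])
    let ?y = "\<lambda>s. ?x + s *\<^sub>R axis i 1"
    have yi: "?y s \<bullet> axis i 1 = s" for s using that by (simp add: inner_add_left inner_axis) (simp add: axis_def)
    have f\<omega>: "\<omega> y = f (norm y)" if "y \<in> ?B" for y unfolding f_def by (rule rad) (use that in auto)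
    have y0: "?y 0 \<noteq> 0" using r by simp
    have dn: "((\<lambda>s. norm (?y s)) has_real_derivative s / norm (?y s)) (at s)" if "?y s \<noteq> 0" for s
      using DERIV_norm_line[OF that] by (simp only: yi)
    have U: "open (?B \<inter> - {0})" by (intro open_Int) auto
    have evU: "\<forall>\<^sub>F s in nhds 0. ?y s \<in> ?B \<inter> - {0}" by (rule eventually_line[OF U]) (use x r in auto)
    have "\<forall>\<^sub>F s in nhds 0. ((\<lambda>s. \<omega> (?y s)) has_real_derivative f1 (norm (?y s)) * (s / norm (?y s))) (at s)"
      using evU
    proof eventually_elim
      case (elim s)
      have "((\<lambda>s. f (norm (?y s))) has_real_derivative f1 (norm (?y s)) * (s / norm (?y s))) (at s)"
        by (rule DERIV_chain2[OF df dn]) (use elim in auto)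
      moreover have "open (?y -` ?B)" by (intro open_vimage continuous_intros) auto
      then have "\<forall>\<^sub>F u in nhds s. u \<in> ?y -` ?B" using elim by (intro eventually_nhds_in_open) auto
      then have "\<forall>\<^sub>F u in nhds s. \<omega> (?y u) = f (norm (?y u))" by eventually_elim (rule f\<omega>, simp)
      ultimately show ?case by (subst DERIV_cong_ev[OF refl _ refl])
    qed
    moreover have "((\<lambda>s. f1 (norm (?y s)) * (s / norm (?y s))) has_real_derivative f1 r / r) (at 0)"
    proof -
      have nr: "norm (?y 0) = r" using r by simp
      have df10: "((\<lambda>s. f1 (norm (?y s))) has_real_derivative partial k (partial k \<omega>) ?x * (0 / norm (?y 0))) (at 0)"
        by (rule DERIV_chain2[OF _ dn[OF y0]]) (use df1[of r] nr r in simp)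
      have "((\<lambda>s. f1 (norm (?y s)) * (s / norm (?y s))) has_real_derivative
        (partial k (partial k \<omega>) ?x * (0 / norm (?y 0))) * (0 / norm (?y 0))
        + (1 * norm (?y 0) - 0 * (0 / norm (?y 0))) / (norm (?y 0) * norm (?y 0)) * f1 (norm (?y 0))) (at 0)"
        by (intro DERIV_mult df10 DERIV_divide DERIV_ident dn y0) (use y0 in simp)
      then show ?thesis using nr r by simp
    qed
    ultimately show "has_dir2 \<omega> ?x (axis i 1) (f1 r / r)" unfolding has_dir2_def
      by (intro exI[of _ "\<lambda>s. f1 (norm (?y s)) * (s / norm (?y s))"] conjI)
  qed
  have "laplacian \<omega> ?x = partial k (partial k \<omega>) ?x + (\<Sum>i\<in>UNIV - {k}. partial i (partial i \<omega>) ?x)"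
    unfolding laplacian_def by (rule sum.remove) auto
  also have "(\<Sum>i\<in>UNIV - {k}. partial i (partial i \<omega>) ?x) = (real CARD('n) - 1) * (f1 r / r)"
    by (simp add: other card_Diff_singleton of_nat_diff)
  finally have "partial k (partial k \<omega>) ?x = laplacian \<omega> ?x - (real CARD('n) - 1) / r * f1 r" by simp
  then show "(f1 has_real_derivative laplacian \<omega> ?x - (real CARD('n) - 1) / r * f1 r) (at r)"
    using df1[of r] r by simp
qed

section \<open>The Morse index\<close>

lemma vector_space_fun: "vector_space (\<lambda>(c::real) (f::'a \<Rightarrow> real) x. c * f x)"
  by unfold_locales (auto simp: fun_eq_iff algebra_simps)

lemma dim_line_fun:
  fixes f :: "'a \<Rightarrow> real"
  assumes "f \<noteq> (\<lambda>_. 0)"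
  shows "vector_space.dim (\<lambda>(c::real) (f::'a \<Rightarrow> real) x. c * f x) (range (\<lambda>c x. c * f x)) = 1"
proof -
  interpret vector_space "\<lambda>(c::real) (f::'a \<Rightarrow> real) x. c * f x" by (rule vector_space_fun)
  have "f \<noteq> 0" using assms by (simp add: zero_fun_def)
  then have "independent {f}" by simp
  then have "dim (span {f}) = 1" by (simp add: dim_eq_card_independent)
  then show ?thesis by (simp add: span_singleton)
qed

lemma inner_axis_sum: "(\<Sum>i\<in>UNIV. (x \<bullet> axis i 1) * (axis i 1 \<bullet> y)) = x \<bullet> (y :: real ^ 'n)"
  by (simp only: inner_axis inner_axis') (simp add: inner_vec_def)

context mems
begin

text \<open>By \<open>w' r = r * b r\<close>, \<open>?h\<close> is up to a factor a directional
  derivative of the profile: it solves the linearised equation at \<open>\<mu> = 0\<close> but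
  vanishes on the hyperplane. The Gaussian \<open>?g\<close> is positive there. Close to the
  hyperplane the large negative second derivative of \<open>?g\<close> gives strictness; farther
  away the term \<open>A * \<mu> * ?h\<close> outweighs every error of \<open>?g\<close>.\<close>

lemma supersolution:
  fixes e :: "real ^ 'n"
  assumes n: "CARD('n) = Suc m" and t: "t > 0" and \<mu>: "\<mu> < 0" and e: "e \<bullet> e = 1"
  shows "\<exists>k. continuous_on UNIV k \<and> (\<forall>x. 0 \<le> x \<bullet> e \<longrightarrow> k x > 0) \<and>
    (\<forall>x\<in>ball 0 1. 0 < x \<bullet> e \<longrightarrow>
      (\<exists>D. (\<forall>i. has_dir2 k x (axis i 1) (D i)) \<and> (\<Sum>i\<in>UNIV. D i) + (t\<^sup>2 * q (t * norm x) + \<mu>) * k x < 0))"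
proof -
  let ?n = "real (Suc m)"
  let ?h = "\<lambda>x :: real ^ 'n. b (t * norm x) * (x \<bullet> e)"
  \<comment> \<open>Chosen so that the potential is at most \<open>K - 1\<close>, which the
    \<open>- 2 * K\<close> from the Gaussian beats.\<close>
  define K where "K = 1 + t\<^sup>2 * p"
  have K: "K \<ge> 1" using p by (simp add: K_def)
  let ?g = "\<lambda>x :: real ^ 'n. exp (- K * (x \<bullet> e)\<^sup>2)"
  obtain z where z: "z \<in> {0..t}" "\<And>y. y \<in> {0..t} \<Longrightarrow> b z \<le> b y"
    using continuous_attains_inf[of "{0..t}" b] continuous_on_subset[OF b_cont] t by (metis atLeastAtMost_iff compact_Icc empty_iff less_imp_le order_refl top_greatest)
  \<comment> \<open>Where \<open>x \<bullet> e > 1 / (2 * K)\<close>, \<open>?h\<close> exceeds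
    \<open>b z / (2 * K)\<close>; this \<open>A\<close> then makes \<open>A * \<mu> * ?h\<close>
    smaller than \<open>- 4 * K\<^sup>2\<close>, while the Gaussian terms are at most
    \<open>4 * K\<^sup>2\<close>.\<close>
  define A where "A = 8 * K ^ 3 / (- \<mu> * b z)"
  have bz: "b z > 0" by (rule b_pos)
  have A: "A > 0" unfolding A_def using K \<mu> bz by (intro divide_pos_pos mult_pos_pos zero_less_power) auto
  let ?k = "\<lambda>x. A * ?h x + ?g x"
  have hc: "continuous_on UNIV ?h"
    by (intro continuous_intros continuous_on_compose2[OF b_cont]) auto
  show ?thesis
  proof (intro exI[of _ ?k] conjI allI impI ballI)
    show "continuous_on UNIV ?k" by (intro continuous_intros hc)
    show "0 < ?k x" if "0 \<le> x \<bullet> e" for x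
      using that A b_pos[of "t * norm x"] by (intro add_nonneg_pos mult_nonneg_nonneg) auto
    fix x :: "real ^ 'n" assume xb: "x \<in> ball 0 1" and xe: "0 < x \<bullet> e"
    define \<rho> where "\<rho> = norm x"
    have x0: "x \<noteq> 0" using xe by auto
    have \<rho>: "0 < \<rho>" "\<rho> < 1" using x0 xb by (auto simp: \<rho>_def)
    let ?B = "\<lambda>r. (src (t * r) - ?n * b (t * r)) / r\<^sup>2"
    have dc: "((\<lambda>r. b (t * r)) has_real_derivative r * ?B r) (at r)" if "r > 0" for r
    proof -
      have "((\<lambda>r. b (t * r)) has_real_derivative (src (t * r) - ?n * b (t * r)) / (t * r) * t) (at r)"
        by (rule DERIV_chain2[OF DERIV_b]) (use t that in \<open>auto intro!: derivative_eq_intros\<close>)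
      then show ?thesis by (rule DERIV_cong) (use t that in \<open>simp add: power2_eq_square\<close>)
    qed
    have dP: "((\<lambda>r. src (t * r)) has_real_derivative - q (t * \<rho>) * (t * \<rho> * b (t * \<rho>)) * t) (at \<rho>)"
      by (rule DERIV_chain2[OF DERIV_src]) (use t \<rho> in \<open>auto intro!: derivative_eq_intros\<close>)
    define B1 where "B1 = ((- q (t * \<rho>) * (t * \<rho> * b (t * \<rho>)) * t - ?n * (\<rho> * ?B \<rho>)) * \<rho>\<^sup>2
        - (src (t * \<rho>) - ?n * b (t * \<rho>)) * (2 * \<rho>)) / (\<rho>\<^sup>2 * \<rho>\<^sup>2)"
    have dB: "(?B has_real_derivative B1) (at \<rho>)"
      unfolding B1_def
    proof (intro DERIV_divide DERIV_diff DERIV_cmult dP dc \<rho>)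
      show "((\<lambda>r. r\<^sup>2) has_real_derivative 2 * \<rho>) (at \<rho>)" by (auto intro!: derivative_eq_intros)
    qed (use \<rho> in auto)
    define Dh where "Dh i = B1 * (x \<bullet> axis i 1)\<^sup>2 * (x \<bullet> e) / norm x + ?B (norm x) * (x \<bullet> e) * (axis i 1 \<bullet> (axis i 1 :: real ^ 'n))
        + 2 * ?B (norm x) * (x \<bullet> axis i 1) * (axis i 1 \<bullet> e)" for i
    have Dh: "has_dir2 ?h x (axis i 1) (Dh i)" for i
      unfolding Dh_def by (rule has_dir2_radial_linear[OF x0 dc]) (use dB in \<open>simp_all add: \<rho>_def\<close>)
    have sq: "(\<Sum>i\<in>UNIV. (x \<bullet> axis i 1)\<^sup>2) = \<rho>\<^sup>2"
      using inner_axis_sum[of x x] by (simp add: \<rho>_def power2_eq_square inner_commute power2_norm_eq_inner[symmetric] flip: power2_eq_square)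
    have "(\<Sum>i\<in>UNIV. Dh i) = B1 * (x \<bullet> e) / \<rho> * (\<Sum>i\<in>UNIV. (x \<bullet> axis i 1)\<^sup>2) + ?n * (?B \<rho> * (x \<bullet> e))
        + 2 * ?B \<rho> * (\<Sum>i\<in>UNIV. (x \<bullet> axis i 1) * (axis i 1 \<bullet> e))"
      unfolding sum_distrib_left Dh_def \<rho>_def[symmetric] sum.distrib
      using n by (simp add: mult_ac inner_axis_axis)
    also have "\<dots> = (x \<bullet> e) * (B1 * \<rho> + (?n + 2) * ?B \<rho>)"
      unfolding sq inner_axis_sum using \<rho> by (simp add: field_simps power2_eq_square)
    also have "B1 * \<rho> + (?n + 2) * ?B \<rho> = - t\<^sup>2 * q (t * \<rho>) * b (t * \<rho>)"
      unfolding B1_def using \<rho> by (simp add: divide_simps) (simp add: algebra_simps eval_nat_numeral)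
    finally have sumDh: "(\<Sum>i\<in>UNIV. Dh i) = - t\<^sup>2 * q (t * norm x) * ?h x" by (simp add: \<rho>_def mult_ac)
    let ?s = "x \<bullet> e"
    define Dg where "Dg i = (4 * K\<^sup>2 * ?s\<^sup>2 - 2 * K) * (axis i 1 \<bullet> e)\<^sup>2 * ?g x" for i
    have Dg: "has_dir2 ?g x (axis i 1) (Dg i)" for i
      unfolding Dg_def by (rule has_dir2_gaussian)
    have "(\<Sum>i\<in>UNIV. (axis i 1 \<bullet> e)\<^sup>2) = 1"
      using inner_axis_sum[of e e] e by (simp add: power2_eq_square inner_commute)
    then have sumDg: "(\<Sum>i\<in>UNIV. Dg i) = (4 * K\<^sup>2 * ?s\<^sup>2 - 2 * K) * ?g x"
      unfolding Dg_def by (simp add: sum_distrib_left[symmetric] sum_distrib_right[symmetric])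
    have V: "t\<^sup>2 * q (t * norm x) \<le> K - 1" unfolding K_def using q_le[of "t * norm x"] by (simp add: mult_left_mono)
    have s1: "?s \<le> 1"
    proof -
      have "norm e = 1" using e by (simp add: norm_eq_1)
      then have "?s \<le> norm x" using norm_cauchy_schwarz[of x e] by simp
      then show ?thesis using xb by simp
    qed
    have h0: "?h x > 0" using xe b_pos by simp
    have g1: "0 < ?g x" "?g x \<le> 1" using K by auto
    have eq: "(\<Sum>i\<in>UNIV. A * Dh i + Dg i) + (t\<^sup>2 * q (t * norm x) + \<mu>) * ?k x
      = A * \<mu> * ?h x + (4 * K\<^sup>2 * ?s\<^sup>2 - 2 * K + t\<^sup>2 * q (t * norm x) + \<mu>) * ?g x"
      unfolding sum.distrib sum_distrib_left[symmetric] sumDh sumDg by (simp add: algebra_simps)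
    have "A * \<mu> * ?h x + (4 * K\<^sup>2 * ?s\<^sup>2 - 2 * K + t\<^sup>2 * q (t * norm x) + \<mu>) * ?g x < 0"
    \<comment> \<open>Up to this height \<open>4 * K\<^sup>2 * ?s\<^sup>2\<close> is at most 1, so
      the coefficient of \<open>?g\<close> is at most \<open>\<mu> - K\<close>.\<close>
    proof (cases "?s \<le> 1 / (2 * K)")
      case True
      have "K * ?s \<le> 1 / 2" using True K by (simp add: field_simps)
      then have "(K * ?s)\<^sup>2 \<le> (1 / 2)\<^sup>2" using K xe by (intro power_mono) auto
      then have "4 * K\<^sup>2 * ?s\<^sup>2 - 2 * K + t\<^sup>2 * q (t * norm x) + \<mu> < 0"
        using V K \<mu> unfolding power_mult_distrib power_divide by simp
      then have "(4 * K\<^sup>2 * ?s\<^sup>2 - 2 * K + t\<^sup>2 * q (t * norm x) + \<mu>) * ?g x < 0" using g1 by (simp add: mult_neg_pos)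
      moreover have "A * \<mu> * ?h x < 0" using A \<mu> h0 by (simp add: mult_pos_neg mult_neg_pos)
      ultimately show ?thesis by linarith
    next
      case False
      have "b z \<le> b (t * norm x)" using z(2)[of "t * norm x"] t xb by (auto simp: mult_left_le)
      then have "b z * ?s \<le> ?h x" using xe by (intro mult_right_mono) auto
      moreover have "b z * (1 / (2 * K)) < b z * ?s" using False bz by (intro mult_strict_left_mono) auto
      ultimately have hl: "b z * (1 / (2 * K)) < ?h x" by linarith
      have "A * \<mu> < 0" using A \<mu> by (simp add: mult_pos_neg)
      then have "A * \<mu> * ?h x < A * \<mu> * (b z * (1 / (2 * K)))" by (rule mult_strict_left_mono_neg[OF hl])
      also have "\<dots> = - (4 * K\<^sup>2)" unfolding A_def using \<mu> bz K by (simp add: field_simps power2_eq_square power3_eq_cube)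
      finally have "A * \<mu> * ?h x < - (4 * K\<^sup>2)" .
      moreover have "(4 * K\<^sup>2 * ?s\<^sup>2 - 2 * K + t\<^sup>2 * q (t * norm x) + \<mu>) * ?g x \<le> 4 * K\<^sup>2"
      proof -
        have "?s\<^sup>2 \<le> 1" using s1 xe by (simp add: power_le_one)
        then have "4 * K\<^sup>2 * ?s\<^sup>2 \<le> 4 * K\<^sup>2" by (simp add: mult_left_le)
        then have "4 * K\<^sup>2 * ?s\<^sup>2 - 2 * K + t\<^sup>2 * q (t * norm x) + \<mu> \<le> 4 * K\<^sup>2" using V K \<mu> by linarith
        then have "(4 * K\<^sup>2 * ?s\<^sup>2 - 2 * K + t\<^sup>2 * q (t * norm x) + \<mu>) * ?g x \<le> 4 * K\<^sup>2 * ?g x" using g1 by (intro mult_right_mono) auto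
        also have "\<dots> \<le> 4 * K\<^sup>2" using g1 by (simp add: mult_left_le)
        finally show ?thesis .
      qed
      ultimately show ?thesis by linarith
    qed
    then show "\<exists>D. (\<forall>i. has_dir2 ?k x (axis i 1) (D i)) \<and> (\<Sum>i\<in>UNIV. D i) + (t\<^sup>2 * q (t * norm x) + \<mu>) * ?k x < 0"
      by (intro exI[of _ "\<lambda>i. A * Dh i + Dg i"] conjI allI has_dir2_add has_dir2_cmult Dh Dg) (simp only: eq)
  qed
qed

text \<open>Two distinct points of equal norm are exchanged by the reflection along the unit vector
  of \<open>x - y\<close>, and \<open>x\<close> lies on the positive side. Comparison gives one
  inequality, exchanging the two points the other.\<close>

lemma eigenfunction_radial:
  fixes \<omega> :: "real ^ 'n \<Rightarrow> real"
  assumes n: "CARD('n) = Suc m" and t: "t > 0" and \<mu>: "\<mu> < 0"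
    and \<omega>: "dirichlet_eigenfunction (\<lambda>x. t\<^sup>2 * q (t * norm x)) \<mu> \<omega>"
    and xy: "x \<in> ball 0 1" "norm x = norm y"
  shows "\<omega> x = \<omega> y"
proof -
  have le: "\<omega> x \<le> \<omega> y" if xy: "x \<in> ball 0 1" "norm x = norm y" for x y
  proof (cases "x = y")
    case False
    define e where "e = (1 / norm (x - y)) *\<^sub>R (x - y)"
    have N: "norm (x - y) > 0" using False by simp
    have e: "e \<bullet> e = 1" using N by (simp add: e_def dot_square_norm power2_eq_square)
    have "x \<bullet> (x - y) = (x - y) \<bullet> (x - y) / 2"
      using xy(2) by (simp add: norm_eq inner_diff_left inner_diff_right inner_commute)
    then have xe: "x \<bullet> e = norm (x - y) / 2" using N by (simp add: e_def dot_square_norm power2_eq_square)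
    have xe0: "0 < x \<bullet> e" using xe N by linarith
    have sx: "hyper_refl e x = y" unfolding hyper_refl_def xe using N by (simp add: e_def)
    obtain k where k: "continuous_on UNIV k" "\<And>x. 0 \<le> x \<bullet> e \<Longrightarrow> k x > 0"
      "\<And>x. x \<in> ball 0 1 \<Longrightarrow> 0 < x \<bullet> e \<Longrightarrow>
        \<exists>D. (\<forall>i. has_dir2 k x (axis i 1) (D i)) \<and> (\<Sum>i\<in>UNIV. D i) + (t\<^sup>2 * q (t * norm x) + \<mu>) * k x < 0"
      using supersolution[OF n t \<mu> e] by blast
    have "\<omega> x \<le> \<omega> (hyper_refl e x)"
    proof (rule half_ball_comparison[OF \<omega> _ e _ k(2) k(3) xy(1) xe0])
      show "continuous_on {x \<in> cball 0 1. 0 \<le> x \<bullet> e} k" by (rule continuous_on_subset[OF k(1) subset_UNIV])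
    qed (simp_all add: norm_hyper_refl[OF e])
    then show ?thesis by (simp add: sx)
  qed simp
  have "y \<in> ball 0 1" using xy by simp
  from antisym[OF le[OF xy] le[OF this xy(2)[symmetric]]] show ?thesis .
qed

lemma DERIV_sol_scaled:
  assumes "t > 0" "r > 0"
  shows "((\<lambda>r. sol \<nu> (t * r)) has_real_derivative - r * (t\<^sup>2 * sol_slope \<nu> (t * r))) (at r)"
    and "((\<lambda>r. t\<^sup>2 * sol_slope \<nu> (t * r)) has_real_derivative
      (t\<^sup>2 * ((q (t * r) + \<nu>) * sol \<nu> (t * r)) - real (Suc m) * (t\<^sup>2 * sol_slope \<nu> (t * r))) / r) (at r)"
proof -
  have l: "((\<lambda>r. t * r) has_real_derivative t) (at r)" by (auto intro!: derivative_eq_intros)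
  have tr: "t * r > 0" using assms by simp
  show "((\<lambda>r. sol \<nu> (t * r)) has_real_derivative - r * (t\<^sup>2 * sol_slope \<nu> (t * r))) (at r)"
    by (rule DERIV_cong[OF DERIV_chain2[OF DERIV_sol[OF tr] l]]) (simp add: power2_eq_square)
  show "((\<lambda>r. t\<^sup>2 * sol_slope \<nu> (t * r)) has_real_derivative
      (t\<^sup>2 * ((q (t * r) + \<nu>) * sol \<nu> (t * r)) - real (Suc m) * (t\<^sup>2 * sol_slope \<nu> (t * r))) / r) (at r)"
    by (rule DERIV_cong[OF DERIV_cmult[OF DERIV_chain2[OF DERIV_sol_slope[OF tr] l]]]) (use assms in \<open>simp add: field_simps power2_eq_square\<close>)
qed

text \<open>After dilation by \<open>t\<close>, both sides restricted to a ray solve the same radial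
  equation, agree at the origin and have derivatives tending to 0 there. This includes
  \<open>\<omega> 0 = 0\<close>, where the eigenfunction vanishes.\<close>

lemma eigenfunction_eq_sol:
  fixes \<omega> :: "real ^ 'n \<Rightarrow> real"
  assumes n: "CARD('n) = Suc m" and t: "t > 0" and \<mu>: "\<mu> < 0"
    and \<omega>: "dirichlet_eigenfunction (\<lambda>x. t\<^sup>2 * q (t * norm x)) \<mu> \<omega>"
    and x: "x \<in> ball 0 1"
  shows "\<omega> x = \<omega> 0 * sol (\<mu> / t\<^sup>2) (t * norm x)"
proof (cases "x = 0")
  case True then show ?thesis by (simp add: sol_0)
next
  case False
  let ?\<nu> = "\<mu> / t\<^sup>2" and ?S = "\<lambda>r. t\<^sup>2 * sol_slope (\<mu> / t\<^sup>2) (t * r)" and ?c = "\<omega> 0"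
  \<comment> \<open>Any coordinate axis serves as the ray, since the eigenfunction is
    radial.\<close>
  obtain k :: 'n where True by simp
  let ?f = "\<lambda>r. \<omega> (r *\<^sub>R axis k 1)" and ?f1 = "\<lambda>r. partial k \<omega> (r *\<^sub>R axis k 1)"
  have C2: "C2_on (ball 0 1) \<omega>" and pde: "\<And>x. x \<in> ball 0 1 \<Longrightarrow> laplacian \<omega> x + t\<^sup>2 * q (t * norm x) * \<omega> x + \<mu> * \<omega> x = 0"
    using \<omega> by (auto simp: dirichlet_eigenfunction_def)
  have rad: "\<And>x y. x \<in> ball 0 1 \<Longrightarrow> norm x = norm y \<Longrightarrow> \<omega> x = \<omega> y"
    by (rule eigenfunction_radial[OF n t \<mu> \<omega>])
  have ode: "(?f has_real_derivative ?f1 r) (at r)"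
      "(?f1 has_real_derivative laplacian \<omega> (r *\<^sub>R axis k 1) - (real CARD('n) - 1) / r * ?f1 r) (at r)"
    if "0 < r" "r < 1" for r
    by (rule radial_laplacian_ode[OF C2]; use rad that in blast)+
  have ode0: "(?f \<longlongrightarrow> \<omega> 0) (at_right 0)" "(?f1 \<longlongrightarrow> 0) (at_right 0)"
    by (rule radial_laplacian_ode[OF C2]; use rad in blast)+
  let ?F = "\<lambda>r. ?f r - ?c * sol ?\<nu> (t * r)" and ?F1 = "\<lambda>r. ?f1 r - ?c * (- r * ?S r)"
  have "?F (norm x) = 0"
  proof (rule radial_ode_unique[where f = ?F and g = ?F1 and R = 1 and m = m
        and Q = "\<lambda>r. t\<^sup>2 * q (t * r) + \<mu>" and K = "t\<^sup>2 * p + \<bar>\<mu>\<bar>"])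
    fix r :: real assume r: "0 < r" "r < 1"
    show "(?F has_real_derivative ?F1 r) (at r)"
      by (intro DERIV_diff DERIV_cmult ode(1) DERIV_sol_scaled t r)
    have "laplacian \<omega> (r *\<^sub>R axis k 1) = - (t\<^sup>2 * q (t * r) + \<mu>) * ?f r"
      using pde[of "r *\<^sub>R axis k 1"] r by (simp add: algebra_simps)
    then have d1: "(?f1 has_real_derivative - (t\<^sup>2 * q (t * r) + \<mu>) * ?f r - real m / r * ?f1 r) (at r)"
      using ode(2)[OF r] n by simp
    have d2: "((\<lambda>r. - r * ?S r) has_real_derivative
       - 1 * ?S r + (t\<^sup>2 * ((q (t * r) + ?\<nu>) * sol ?\<nu> (t * r)) - real (Suc m) * ?S r) / r * (- r)) (at r)"
      by (intro DERIV_mult DERIV_minus DERIV_ident DERIV_sol_scaled t r)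
    show "(?F1 has_real_derivative - (real m / r * ?F1 r) - (t\<^sup>2 * q (t * r) + \<mu>) * ?F r) (at r)"
      by (rule DERIV_cong[OF DERIV_diff[OF d1 DERIV_cmult[OF d2, of ?c]]]) (use r t in \<open>simp add: field_simps\<close>)
    have "0 \<le> t\<^sup>2 * q (t * r)" using q_pos[of "t * r"] by simp
    moreover have "t\<^sup>2 * q (t * r) \<le> t\<^sup>2 * p" using q_le by (intro mult_left_mono) auto
    ultimately show "\<bar>t\<^sup>2 * q (t * r) + \<mu>\<bar> \<le> t\<^sup>2 * p + \<bar>\<mu>\<bar>" by linarith
  next
    have "continuous_on UNIV (\<lambda>r. sol ?\<nu> (t * r))" "continuous_on UNIV ?S"
      by (intro continuous_intros continuous_on_compose2[OF sol_cont1[of UNIV]] continuous_on_compose2[OF sol_slope_cont]; simp)+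
    note lim = this[THEN tendsto_at_right_0]
    show "(?F \<longlongrightarrow> 0) (at_right 0)"
      using tendsto_diff[OF ode0(1) tendsto_mult[OF tendsto_const[of ?c] lim(1)]] by (simp add: sol_0)
    have "((\<lambda>r. ?f1 r - ?c * (- r * ?S r)) \<longlongrightarrow> 0 - ?c * (- 0 * ?S 0)) (at_right 0)"
      by (intro tendsto_intros ode0(2) lim(2))
    then show "(?F1 \<longlongrightarrow> 0) (at_right 0)" by simp
  qed (use x False in auto)
  moreover have "\<omega> x = ?f (norm x)" by (rule rad) (use x in auto)
  ultimately show ?thesis by simp
qed

text \<open>The zero at \<open>t\<close> makes the cut-off continuous across the sphere, and
  \<open>?H\<close>, the quadratic remainder at the origin, is read off from
  \<open>sol_fixpoint\<close>. The free constant \<open>c\<close> provides the whole line of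
  eigenfunctions at once.\<close>

lemma sol_eigenfunction:
  assumes n: "CARD('n) = Suc m" and t: "t > 0" and z: "sol (\<mu> / t\<^sup>2) t = 0"
  shows "dirichlet_eigenfunction (\<lambda>x :: real ^ 'n. t\<^sup>2 * q (t * norm x)) \<mu>
    (\<lambda>x. if norm x < 1 then c * sol (\<mu> / t\<^sup>2) (t * norm x) else 0)"
    (is "dirichlet_eigenfunction ?V \<mu> ?\<omega>")
proof -
  let ?\<nu> = "\<mu> / t\<^sup>2"
  let ?Y = "\<lambda>r. c * sol ?\<nu> (t * r)" and ?S = "\<lambda>r. c * (t\<^sup>2 * sol_slope ?\<nu> (t * r))"
    and ?G = "\<lambda>r. c * (t\<^sup>2 * ((q (t * r) + ?\<nu>) * sol ?\<nu> (t * r)))" and ?H = "\<lambda>r. c * (t\<^sup>2 * avg 1 (sol_slope ?\<nu>) (t * r))"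
  have sc: "continuous_on UNIV (\<lambda>r. F (t * r))" if "continuous_on UNIV F" for F :: "real \<Rightarrow> real"
    by (rule continuous_on_compose2[OF that]) (auto intro!: continuous_intros)
  have S0: "real CARD('n) * ?S 0 = ?G 0" using n by (simp add: sol_slope_0)
  have Y0: "?Y r = ?Y 0 - r\<^sup>2 * ?H r" for r
    by (subst sol_fixpoint[of ?\<nu> "t * r"]) (simp add: sol_0 power_mult_distrib algebra_simps)
  have dY: "(?Y has_real_derivative - r * ?S r) (at r)" if "r > 0" for r
    by (rule DERIV_cong[OF DERIV_cmult[OF DERIV_sol_scaled(1)[OF t that]]]) simp
  have dS: "(?S has_real_derivative (?G r - real CARD('n) * ?S r) / r) (at r)" if "r > 0" for r
    by (rule DERIV_cong[OF DERIV_cmult[OF DERIV_sol_scaled(2)[OF t that]]]) (use n that in \<open>simp add: field_simps\<close>)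
  have c1: "continuous_on UNIV ?S" "continuous_on UNIV ?G" "continuous_on UNIV ?H"
    by (intro continuous_intros sc sol_slope_cont q_cont sol_cont1 continuous_on_avg)+
  let ?f = "\<lambda>x :: real ^ 'n. ?Y (norm x)"
  have rad: "C2_on UNIV ?f" "laplacian ?f x = - ?G (norm x)" for x
    by (rule radial_C2[where S = ?S and G = ?G and H = ?H]; (rule dY dS c1 S0 Y0 | assumption)+)+
  have cg: "C2_on (ball 0 1) ?\<omega>" "\<And>x. x \<in> ball 0 1 \<Longrightarrow> laplacian ?\<omega> x = laplacian ?f x"
    by (rule C2_on_cong[OF open_ball[of 0 1] _ rad(1) subset_UNIV]; simp)+
  show ?thesis
    unfolding dirichlet_eigenfunction_def
  proof (intro conjI ballI allI impI)
    show "C2_on (ball 0 1) ?\<omega>" by (rule cg(1))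
    have "continuous_on (cball 0 1) ?f"
      by (intro continuous_intros continuous_on_compose2[OF sol_cont1[of UNIV]]) auto
    then show "continuous_on (cball 0 1) ?\<omega>"
      by (rule continuous_on_eq) (use z in \<open>auto simp: le_less\<close>)
    fix x :: "real ^ 'n"
    show "?\<omega> x = 0" if "1 \<le> norm x" using that by simp
    assume x: "x \<in> ball 0 1"
    have "laplacian ?\<omega> x = - ?G (norm x)" using cg(2)[OF x] rad(2)[of x] by simp
    also have "?G (norm x) = t\<^sup>2 * q (t * norm x) * ?\<omega> x + \<mu> * ?\<omega> x"
      using x t by (simp add: algebra_simps)
    finally show "laplacian ?\<omega> x + t\<^sup>2 * q (t * norm x) * ?\<omega> x + \<mu> * ?\<omega> x = 0" by simp
  qed
qed

text \<open>Inside the ball an eigenfunction is \<open>\<omega> 0\<close> times the dilated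
  solution, with \<open>\<omega> 0 \<noteq> 0\<close> unless it vanishes identically; letting a
  point on a ray tend to the sphere turns the boundary condition into
  \<open>sol (\<mu> / t\<^sup>2) t = 0\<close>.\<close>

lemma eigenspace:
  fixes t \<mu> :: real
  assumes n: "CARD('n) = Suc m" and t: "t > 0" and \<mu>: "\<mu> < 0"
  defines "V \<equiv> (\<lambda>x :: real ^ 'n. t\<^sup>2 * q (t * norm x))"
  shows "dirichlet_eigenvalue V \<mu> \<longleftrightarrow> sol (\<mu> / t\<^sup>2) t = 0"
    and "dirichlet_eigenvalue V \<mu> \<Longrightarrow> eig_multiplicity V \<mu> = 1"
proof -
  let ?\<omega> = "\<lambda>x :: real ^ 'n. if norm x < 1 then sol (\<mu> / t\<^sup>2) (t * norm x) else 0"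
  have out: "\<omega> x = \<omega> 0 * ?\<omega> x" if "dirichlet_eigenfunction V \<mu> \<omega>" for \<omega> x
    using eigenfunction_eq_sol[OF n t \<mu> that[unfolded V_def], of x] that
    by (auto simp: dirichlet_eigenfunction_def)
  have \<omega>0: "?\<omega> \<noteq> (\<lambda>_. 0)" by (auto simp: fun_eq_iff sol_0 intro!: exI[of _ 0])
  have z: "sol (\<mu> / t\<^sup>2) t = 0" if eig: "dirichlet_eigenvalue V \<mu>"
  proof -
    obtain \<omega> where \<omega>: "dirichlet_eigenfunction V \<mu> \<omega>" "\<omega> \<noteq> (\<lambda>_. 0)" using eig by (auto simp: dirichlet_eigenvalue_def)
    have c: "\<omega> 0 \<noteq> 0" using out[OF \<omega>(1)] \<omega>(2) by (metis mult_zero_left)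
    obtain k :: 'n where True by simp
    let ?x = "\<lambda>r. r *\<^sub>R axis k 1 :: real ^ 'n"
    have cont: "continuous_on (cball 0 1) \<omega>" and bd: "\<omega> (?x 1) = 0"
      using \<omega>(1) by (auto simp: dirichlet_eigenfunction_def)
    have "continuous_on {0..1} (\<lambda>r. \<omega> (?x r))"
      by (rule continuous_on_compose2[OF cont]) (auto intro!: continuous_intros)
    then have "((\<lambda>r. \<omega> (?x r)) \<longlongrightarrow> 0) (at 1 within {0..1})" using bd by (auto simp: continuous_on_def dest: bspec[of _ _ 1])
    then have l1: "((\<lambda>r. \<omega> (?x r)) \<longlongrightarrow> 0) (at_left 1)" by (simp add: at_within_Icc_at_left)
    have "continuous_on UNIV (\<lambda>r. \<omega> 0 * sol (\<mu> / t\<^sup>2) (t * r))"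
      by (intro continuous_intros continuous_on_compose2[OF sol_cont1[of UNIV]]) auto
    then have "isCont (\<lambda>r. \<omega> 0 * sol (\<mu> / t\<^sup>2) (t * r)) 1" by (simp add: continuous_on_eq_continuous_at)
    then have "((\<lambda>r. \<omega> 0 * sol (\<mu> / t\<^sup>2) (t * r)) \<longlongrightarrow> \<omega> 0 * sol (\<mu> / t\<^sup>2) (t * 1)) (at_left 1)"
      unfolding isCont_def by (rule tendsto_within_subset) simp
    moreover have "\<forall>\<^sub>F r in at_left 1. \<omega> 0 * sol (\<mu> / t\<^sup>2) (t * r) = \<omega> (?x r)"
      using eventually_at_left_real[of 0 "1::real", simplified]
    proof eventually_elim
      case (elim r)
      then show ?case using out[OF \<omega>(1), of "?x r"] by simp
    qed
    ultimately have "((\<lambda>r. \<omega> (?x r)) \<longlongrightarrow> \<omega> 0 * sol (\<mu> / t\<^sup>2) (t * 1)) (at_left 1)"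
      by (simp add: tendsto_cong)
    with l1 have "\<omega> 0 * sol (\<mu> / t\<^sup>2) (t * 1) = 0" using tendsto_unique[OF trivial_limit_at_left_real] by blast
    then show ?thesis using c by simp
  qed
  have ef: "dirichlet_eigenfunction V \<mu> (\<lambda>x. c * ?\<omega> x)" if "sol (\<mu> / t\<^sup>2) t = 0" for c
    using sol_eigenfunction[OF n t that, of c] unfolding V_def by (simp add: if_distrib cong: if_cong)
  show "dirichlet_eigenvalue V \<mu> \<longleftrightarrow> sol (\<mu> / t\<^sup>2) t = 0"
    using z ef[of 1] \<omega>0 by (auto simp: dirichlet_eigenvalue_def)
  assume "dirichlet_eigenvalue V \<mu>"
  then have "sol (\<mu> / t\<^sup>2) t = 0" by (rule z)
  then have "{\<omega>. dirichlet_eigenfunction V \<mu> \<omega>} = range (\<lambda>c x. c * ?\<omega> x)"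
    using ef out by (auto intro!: ext)
  then show "eig_multiplicity V \<mu> = 1"
    unfolding eig_multiplicity_def using dim_line_fun[OF \<omega>0] by simp
qed

lemma morse_index_eq_neg_count:
  assumes n: "CARD('n) = Suc m" and t: "t > 0"
  shows "morse_index (mems_potential p w t :: real ^ 'n \<Rightarrow> real) = neg_count t"
proof -
  let ?V = "\<lambda>x :: real ^ 'n. t\<^sup>2 * q (t * norm x)"
  let ?E = "{\<mu>. \<mu> < 0 \<and> dirichlet_eigenvalue ?V \<mu>}"
  note es = eigenspace[OF n t]
  have "morse_index ?V = (\<Sum>\<mu>\<in>?E. 1)"
    unfolding morse_index_def by (rule sum.cong[OF refl]) (use es(2) in auto)
  also have "?E = (\<lambda>\<nu>. t\<^sup>2 * \<nu>) ` {\<nu>. \<nu> < 0 \<and> sol \<nu> t = 0}"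
  proof (rule equalityI[OF subsetI])
    fix \<mu> assume "\<mu> \<in> ?E"
    then show "\<mu> \<in> (\<lambda>\<nu>. t\<^sup>2 * \<nu>) ` {\<nu>. \<nu> < 0 \<and> sol \<nu> t = 0}"
      using es(1)[of \<mu>] t by (intro image_eqI[of _ _ "\<mu> / t\<^sup>2"]) (auto simp: divide_neg_pos)
  next
    show "(\<lambda>\<nu>. t\<^sup>2 * \<nu>) ` {\<nu>. \<nu> < 0 \<and> sol \<nu> t = 0} \<subseteq> ?E"
    proof (rule image_subsetI)
      fix \<nu> assume "\<nu> \<in> {\<nu>. \<nu> < 0 \<and> sol \<nu> t = 0}"
      moreover then have "t\<^sup>2 * \<nu> < 0" using t by (simp add: mult_pos_neg)
      ultimately show "t\<^sup>2 * \<nu> \<in> ?E" using es(1)[of "t\<^sup>2 * \<nu>"] t by simp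
    qed
  qed
  also have "(\<Sum>\<mu>\<in>\<dots>. 1::nat) = neg_count t"
    unfolding neg_count_def using t by (subst sum.reindex) (auto simp: inj_on_def)
  finally show ?thesis by (simp add: potential_eq[OF t])
qed

end

theorem theorem5p3:
  fixes p :: real and w :: "real \<Rightarrow> real" and tn :: real
  assumes "p > 0"
    and "mems_profile CARD('n::finite) p w"
    and "tn > 0"
    and "deriv (mems_lambda p w) tn = 0"
  shows "deriv (deriv (mems_lambda p w)) tn \<noteq> 0 \<and>
         (\<exists>\<delta>>0. \<forall>t s. tn < t \<and> t < tn + \<delta> \<and> tn - \<delta> < s \<and> s < tn \<longrightarrow>
           morse_index (mems_potential p w t :: real^'n \<Rightarrow> real)
             = morse_index (mems_potential p w s :: real^'n \<Rightarrow> real) + 1)"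
proof -
  define m where "m = CARD('n) - 1"
  have n: "CARD('n) = Suc m" by (simp add: m_def)
  obtain w' where "mems m p w w'"
    using assms(1,2) n by (auto simp: mems_profile_def mems_def)
  then interpret mems m p w w' .
  obtain \<delta> where \<delta>: "\<delta> > 0"
    "\<And>t s. tn < t \<and> t < tn + \<delta> \<and> tn - \<delta> < s \<and> s < tn \<Longrightarrow> neg_count t = neg_count s + 1"
    using turning_point(2)[OF assms(3,4)] by blast
  show ?thesis
  \<comment> \<open>The minimum with \<open>tn\<close> keeps \<open>s\<close> positive, as the
    identification of the index with \<open>neg_count\<close> requires.\<close>
  proof (intro conjI exI[of _ "min \<delta> tn"] allI impI turning_point(1)[OF assms(3,4)])
    fix t s assume ts: "tn < t \<and> t < tn + min \<delta> tn \<and> tn - min \<delta> tn < s \<and> s < tn"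
    then have "neg_count t = neg_count s + 1" by (intro \<delta>) auto
    then show "morse_index (mems_potential p w t :: real^'n \<Rightarrow> real)
             = morse_index (mems_potential p w s :: real^'n \<Rightarrow> real) + 1"
      using morse_index_eq_neg_count[OF n, of t] morse_index_eq_neg_count[OF n, of s] ts assms(3) by auto
  qed (use \<delta> assms(3) in auto)
qed

end
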